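(* Let $(E_0,E_1)$ and $(H_0,H_1)$ be two pairs of complex Banach spaces such that $E_1$ is densely embedded into $E_0$ with $\|x\|_{E_0}\le \|x\|_{E_1}$ for all $x\in E_1$, and $H_1$ is densely and continuously embedded into $H_0$. For $\theta\in[0,1]$ let $E_\theta=[E_0,E_1]_\theta$ and $H_\theta=[H_0,H_1]_\theta$ be the complex interpolation spaces, and let $B_\theta(0,R)$ denote the open ball of radius $R$ centered at $0$ in $E_\theta$. Let $R>0$ and let $\Phi$ be an analytic map from the ball $B_0(0,R)$ into $H_0$ such that $$\|\Phi(x)\|_{H_0}\le C_0(R)\|x\|_{E_0},\qquad x\in B_0(0,R).$$ Suppose also that $\Phi$ maps the ball $B_1(0,R)$ into $H_1$ and $$\|\Phi(x)\|_{H_1}\le C_1(R)\|x\|_{E_1},\qquad x\in B_1(0,R).$$ Then for every $\theta\in[0,1]$ and every $r\in(0,R)$, $\Phi$ maps the ball $B_\theta(0,r)$ into $H_\theta$, and $$\|\Phi(x)\|_{H_\theta}\le C_0(R)^{1-\theta}C_1(R)^{\theta}\,\frac{R}{R-r}\,\|x\|_{E_\theta},\qquad x\in B_\theta(0,r).$$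
   Context: Complex interpolation: for a pair $(X_0,X_1)$ of Banach spaces with $X_1$ continuously embedded in $X_0$, let $\mathcal F(X_0,X_1)$ be the space of bounded functions $f$ on the closed strip $\{0\le \operatorname{Re} z\le 1\}$ with values in $X_0$, continuous on the closed strip and analytic in the open strip $\{0<\operatorname{Re} z<1\}$, such that $t\mapsto f(it)$ is continuous into $X_0$, $f(1+it)\in X_1$ for all real $t$ with $t\mapsto f(1+it)$ continuous into $X_1$, and $\|f(it)\|_{X_0}\to 0$, $\|f(1+it)\|_{X_1}\to0$ as $|t|\to\infty$; it is normed by $\|f\|_{\mathcal F}=\max\{\sup_t\|f(it)\|_{X_0},\sup_t\|f(1+it)\|_{X_1}\}$. Then $[X_0,X_1]_\theta=\{f(\theta): f\in\mathcal F(X_0,X_1)\}$ with norm $\|x\|_{[X_0,X_1]_\theta}=\inf\{\|f\|_{\mathcal F}: f(\theta)=x\}$. Analyticity of $\Phi$ is in the usual sense for maps between complex Banach spaces (locally given by convergent series of homogeneous polynomials, equivalently complex Fréchet differentiable). *)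

theory Defs
  imports "HOL-Analysis.Analysis"
begin

class complex_normed_vector = real_normed_vector +
  fixes scaleC :: "complex \<Rightarrow> 'a \<Rightarrow> 'a"  (infixr \<open>*\<^sub>C\<close> 75)
  assumes scaleC_add_right: "a *\<^sub>C (x + y) = a *\<^sub>C x + a *\<^sub>C y"
    and scaleC_add_left: "(a + b) *\<^sub>C x = a *\<^sub>C x + b *\<^sub>C x"
    and scaleC_scaleC: "a *\<^sub>C (b *\<^sub>C x) = (a * b) *\<^sub>C x"
    and scaleC_one: "1 *\<^sub>C x = x"
    and scaleC_of_real: "complex_of_real r *\<^sub>C x = r *\<^sub>R x"
    and norm_scaleC: "norm (a *\<^sub>C x) = cmod a * norm x"

definition banach_embedded :: "'a::complex_normed_vector set \<Rightarrow> ('a \<Rightarrow> real) \<Rightarrow> bool" where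
  "banach_embedded X n \<longleftrightarrow>
     0 \<in> X \<and> (\<forall>x\<in>X. \<forall>y\<in>X. x + y \<in> X) \<and> (\<forall>c. \<forall>x\<in>X. c *\<^sub>C x \<in> X)
   \<and> (\<forall>x\<in>X. 0 \<le> n x \<and> (n x = 0 \<longleftrightarrow> x = 0))
   \<and> (\<forall>x\<in>X. \<forall>y\<in>X. n (x + y) \<le> n x + n y)
   \<and> (\<forall>c. \<forall>x\<in>X. n (c *\<^sub>C x) = cmod c * n x)
   \<and> (\<forall>s::nat \<Rightarrow> 'a. (\<forall>k. s k \<in> X) \<and> (\<forall>e>0. \<exists>N. \<forall>j\<ge>N. \<forall>k\<ge>N. n (s j - s k) < e)
          \<longrightarrow> (\<exists>l\<in>X. \<forall>e>0. \<exists>N. \<forall>k\<ge>N. n (s k - l) < e))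
   \<and> (\<exists>C. \<forall>x\<in>X. norm x \<le> C * n x)
   \<and> closure X = UNIV"

definition strip :: "complex set" where
  "strip = {z. 0 \<le> Re z \<and> Re z \<le> 1}"

definition open_strip :: "complex set" where
  "open_strip = {z. 0 < Re z \<and> Re z < 1}"

definition complex_frechet_differentiable ::
    "('a::complex_normed_vector \<Rightarrow> 'b::complex_normed_vector) \<Rightarrow> 'a \<Rightarrow> bool" where
  "complex_frechet_differentiable f x \<longleftrightarrow>
     (\<exists>L. (f has_derivative L) (at x) \<and> (\<forall>c h. L (c *\<^sub>C h) = c *\<^sub>C L h))"

text \<open>The class F(X0,X1) of the complex interpolation method, X0 the ambient
space, (X1, n1) the embedded one.\<close>

definition interp_F :: "'a::complex_normed_vector set \<Rightarrow> ('a \<Rightarrow> real) \<Rightarrow> (complex \<Rightarrow> 'a) \<Rightarrow> bool" where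
  "interp_F X1 n1 f \<longleftrightarrow>
     bounded (f ` strip)
   \<and> continuous_on strip f
   \<and> (\<forall>z\<in>open_strip. \<exists>v. (f has_derivative (\<lambda>h. h *\<^sub>C v)) (at z))
   \<and> continuous_on UNIV (\<lambda>t::real. f (\<i> * complex_of_real t))
   \<and> (\<forall>t::real. f (1 + \<i> * complex_of_real t) \<in> X1)
   \<and> (\<forall>t::real. \<forall>e>0. \<exists>d>0. \<forall>s::real. \<bar>s - t\<bar> < d \<longrightarrow>
          n1 (f (1 + \<i> * complex_of_real s) - f (1 + \<i> * complex_of_real t)) < e)
   \<and> ((\<lambda>t::real. norm (f (\<i> * complex_of_real t))) \<longlongrightarrow> 0) at_infinity
   \<and> ((\<lambda>t::real. n1 (f (1 + \<i> * complex_of_real t))) \<longlongrightarrow> 0) at_infinity"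

definition interp_F_norm :: "('a::complex_normed_vector \<Rightarrow> real) \<Rightarrow> (complex \<Rightarrow> 'a) \<Rightarrow> real" where
  "interp_F_norm n1 f =
     max (SUP t::real. norm (f (\<i> * complex_of_real t)))
         (SUP t::real. n1 (f (1 + \<i> * complex_of_real t)))"

definition interp_space :: "'a::complex_normed_vector set \<Rightarrow> ('a \<Rightarrow> real) \<Rightarrow> real \<Rightarrow> 'a set" where
  "interp_space X1 n1 \<theta> = {f (complex_of_real \<theta>) | f. interp_F X1 n1 f}"

definition interp_norm :: "'a::complex_normed_vector set \<Rightarrow> ('a \<Rightarrow> real) \<Rightarrow> real \<Rightarrow> 'a \<Rightarrow> real" where
  "interp_norm X1 n1 \<theta> x =
     Inf {interp_F_norm n1 f | f. interp_F X1 n1 f \<and> f (complex_of_real \<theta>) = x}"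

text \<open>Real power with the convention a^0 = 1 (Isabelle's powr has 0 powr 0 = 0).\<close>

definition rpow :: "real \<Rightarrow> real \<Rightarrow> real" where
  "rpow a b = (if b = 0 then 1 else a powr b)"

end

theory Submission
  imports Defs "HOL-Complex_Analysis.Conformal_Mappings" "HOL-Real_Asymp.Real_Asymp"
begin

text \<open>
  For an admissible $f$ with $f(\theta) = x$ and norm below $R$, the three lines theorem keeps $f$
  inside the ball of radius $R$, and $h(z) = (C_0/C_1)^{z-\theta}\, \Phi(f(z))$ is admissible for
  the target pair with norm at most $C_0^{1-\theta} C_1^\theta$ times that of $f$ (vanishing
  constants are perturbed). No loss $R/(R-r)$ occurs.

  The delicate point is continuity of $t \mapsto h(1+it)$ into $H_1$: along complex lines in
  $E_1$ the map $\Phi$ is bounded in $H_1$ but holomorphic only into $H_0$. To obtain a Lipschitz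
  bound, the functional $g \mapsto g(z) - g(0)$ on scalar holomorphic functions is written as
  $\sum_k \mu_k g(p_k)$ with points $p_k$ in the unit disc and $\sum_k |\mu_k| \le K|z|$. Applied to the
  $H_1$-bounded function, the series converges in $H_1$ with norm $O(|z|)$, and the functionals
  on $H_0$, which separate points, identify its sum with the increment.
\<close>

section \<open>Hahn--Banach\<close>

text \<open>Cauchy's integral formula would give the Lipschitz bound at once if it could be read in
  $H_1$. But along a complex line the map is only known to be bounded there, neither continuous nor
  measurable, so the integral has no meaning in advance. A countable sum of point evaluations asks
  only for boundedness and completeness. Functionals on $H_0$ must identify its limit, since a
  functional continuous for the $H_1$ norm need not extend to $H_0$, where holomorphy is known. The
  sum arises by discretising the Cauchy integral at roots of unity. Finitely many Taylor
  coefficients are reproduced; the error is again a functional on power series and is treated in the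
  same way at a slightly larger radius. The radii stay below 1, so their gaps shrink and the steps
  become more expensive. This does no harm: the cost of a step depends on its two radii alone, while
  its accuracy can be chosen freely.\<close>

definition sublinear :: "('a::real_vector \<Rightarrow> real) \<Rightarrow> bool" where
  "sublinear p \<longleftrightarrow> (\<forall>x y. p (x + y) \<le> p x + p y) \<and> (\<forall>c\<ge>0. \<forall>x. p (c *\<^sub>R x) \<le> c * p x)"

lemma sublinear_add: "sublinear p \<Longrightarrow> p (x + y) \<le> p x + p y"
  by (simp add: sublinear_def)

lemma sublinear_scaleR_le: "sublinear p \<Longrightarrow> c \<ge> 0 \<Longrightarrow> p (c *\<^sub>R x) \<le> c * p x"
  by (simp add: sublinear_def)

lemma sublinear_zero: assumes "sublinear p" shows "p 0 = 0"
  using sublinear_add[OF assms, of 0 0] sublinear_scaleR_le[OF assms, of 0 0] by simp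

lemma sublinear_scaleR:
  assumes p: "sublinear p" and c: "c \<ge> 0" shows "p (c *\<^sub>R x) = c * p x"
proof (cases "c = 0")
  case False
  have "p ((1 / c) *\<^sub>R (c *\<^sub>R x)) \<le> (1 / c) * p (c *\<^sub>R x)"
    using sublinear_scaleR_le[OF p, of "1 / c" "c *\<^sub>R x"] c by simp
  with False c have "c * p x \<le> p (c *\<^sub>R x)" by (simp add: field_simps)
  with sublinear_scaleR_le[OF p c, of x] show ?thesis by simp
qed (simp add: sublinear_zero[OF p])

lemma sublinear_minus: assumes "sublinear p" shows "- p (- x) \<le> p x"
  using sublinear_add[OF assms, of x "- x"] sublinear_zero[OF assms] by simp

text \<open>The witness is the infimum of \<open>p (x + t *\<^sub>R v) - t * p v\<close> over
  \<open>t \<ge> 0\<close>. The values \<open>t = 0\<close> and \<open>t = 1\<close> give the two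
  upper bounds, \<open>- p (- x)\<close> bounds the infimum from below, and subadditivity holds
  because parameters for \<open>x\<close> and \<open>y\<close> may be added.\<close>

lemma sublinear_improve:
  fixes p :: "'a::real_vector \<Rightarrow> real"
  assumes p: "sublinear p"
  obtains q where "sublinear q" "\<And>x. q x \<le> p x" "\<And>x. q x \<le> p (x + v) - p v"
proof
  define F where "F x t = p (x + t *\<^sub>R v) - t * p v" for x t
  define q where "q x = (INF t\<in>{0..}. F x t)" for x
  have lb: "- p (- x) \<le> F x t" if "t \<ge> 0" for x t
    using sublinear_add[OF p, of "x + t *\<^sub>R v" "- x"] sublinear_scaleR[OF p that, of v]
    by (simp add: F_def)
  have bdd: "bdd_below (F x ` {0..})" for x
    by (rule bdd_belowI2[of _ "- p (- x)"]) (use lb in auto)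
  have le: "q x \<le> F x t" if "t \<ge> 0" for x t
    unfolding q_def by (rule cINF_lower[OF bdd]) (use that in auto)
  have ge: "b \<le> q x" if "\<And>t. t \<ge> 0 \<Longrightarrow> b \<le> F x t" for b x
    unfolding q_def by (rule cINF_greatest) (use that in auto)
  show "q x \<le> p x" for x using le[of 0 x] by (simp add: F_def)
  show "q x \<le> p (x + v) - p v" for x using le[of 1 x] by (simp add: F_def)
  have add: "q (x + y) \<le> q x + q y" for x y
  proof -
    have "q (x + y) \<le> F x t + F y s" if "t \<ge> 0" "s \<ge> 0" for t s
      using le[of "t + s" "x + y"] that sublinear_add[OF p, of "x + t *\<^sub>R v" "y + s *\<^sub>R v"]
      by (simp add: F_def algebra_simps)
    then have "q (x + y) - F x t \<le> q y" if "t \<ge> 0" for t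
      using that by (intro ge) (simp add: algebra_simps)
    then have "q (x + y) - q y \<le> q x"
      by (intro ge) (simp add: algebra_simps)
    then show ?thesis by simp
  qed
  have "q (c *\<^sub>R x) \<le> c * q x" if c: "c \<ge> 0" for c x
  proof (cases "c = 0")
    case True
    then show ?thesis using le[of 0 0] by (simp add: F_def sublinear_zero[OF p])
  next
    case False
    with c have c: "c > 0" by simp
    have "q (c *\<^sub>R x) / c \<le> F x t" if "t \<ge> 0" for t
      using le[of "c * t" "c *\<^sub>R x"] that c sublinear_scaleR[OF p, of c "x + t *\<^sub>R v"]
      by (simp add: F_def field_simps scaleR_add_right)
    then have "q (c *\<^sub>R x) / c \<le> q x" by (rule ge)
    with c show ?thesis by (simp add: field_simps)
  qed
  with add show "sublinear q" by (simp add: sublinear_def)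
qed

text \<open>A pointwise minimal sublinear functional is linear: the improvement above cannot lower it.\<close>

lemma hahn_banach_sublinear:
  fixes p :: "'a::real_vector \<Rightarrow> real"
  assumes p: "sublinear p"
  obtains q where "linear q" "\<And>x. q x \<le> p x"
proof -
  define A where "A = {q. sublinear q \<and> q \<le> p}"
  \<comment> \<open>The order is reversed, so that the maximal element from Zorn's lemma is a
    minimal functional.\<close>
  have po: "partial_order_on A (relation_of (\<ge>) A)"
    by (rule partial_order_on_relation_ofI) auto
  have "\<exists>u\<in>A. \<forall>a\<in>C. a \<ge> u" if C: "C \<in> Chains (relation_of (\<ge>) A)" for C
  proof (cases "C = {}")
    case True
    then show ?thesis using p by (auto simp: A_def)
  next
    case False
    have CA: "C \<subseteq> A" using C by (auto simp: Chains_def relation_of_def)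
    have tot: "q \<le> q' \<or> q' \<le> q" if "q \<in> C" "q' \<in> C" for q q'
      using C that by (auto simp: Chains_def relation_of_def)
    have sub: "sublinear q" "q x \<le> p x" if "q \<in> C" for q x
      using CA that by (auto simp: A_def le_fun_def)
    define u where "u x = (INF q\<in>C. q x)" for x
    have bdd: "bdd_below ((\<lambda>q. q x) ` C)" for x
    proof (rule bdd_belowI2)
      show "- p (- x) \<le> q x" if "q \<in> C" for q
        using sublinear_minus[OF sub(1)[OF that], of x] sub(2)[OF that, of "- x"] by simp
    qed
    have le: "u x \<le> q x" if "q \<in> C" for q x
      unfolding u_def by (rule cINF_lower[OF bdd that])
    have ge: "b \<le> u x" if "\<And>q. q \<in> C \<Longrightarrow> b \<le> q x" for b x
      unfolding u_def by (rule cINF_greatest[OF False that])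
    have add: "u (x + y) \<le> u x + u y" for x y
    proof -
      \<comment> \<open>Two members of a chain are comparable, and the smaller one can be used at
        both arguments.\<close>
      have le2: "u (x + y) \<le> q x + q' y" if qq: "q \<in> C" "q' \<in> C" for q q'
        using tot[OF qq] le[OF qq(1), of "x + y"] le[OF qq(2), of "x + y"]
          sublinear_add[OF sub(1)[OF qq(1)], of x y] sublinear_add[OF sub(1)[OF qq(2)], of x y]
        unfolding le_fun_def by (meson add_mono order_refl order_trans)
      have "u (x + y) - q x \<le> u y" if "q \<in> C" for q
        using le2[OF that] by (intro ge) (simp add: algebra_simps)
      then have "u (x + y) - u y \<le> u x"
        by (intro ge) (simp add: algebra_simps)
      then show ?thesis by simp
    qed
    have "u (c *\<^sub>R x) \<le> c * u x" if c: "c \<ge> 0" for c x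
    proof (cases "c = 0")
      case True
      then show ?thesis using False le[of _ 0] sublinear_zero[OF sub(1)] by fastforce
    next
      case False
      with c have c: "c > 0" by simp
      have "u (c *\<^sub>R x) / c \<le> q x" if "q \<in> C" for q
        using le[OF that, of "c *\<^sub>R x"] sublinear_scaleR[OF sub(1)[OF that], of c x] c
        by (simp add: field_simps)
      then have "u (c *\<^sub>R x) / c \<le> u x" by (rule ge)
      with c show ?thesis by (simp add: field_simps)
    qed
    with add have "sublinear u" by (simp add: sublinear_def)
    moreover have "u \<le> p" using le sub(2) False by (meson ex_in_conv le_funI order_trans)
    ultimately show ?thesis using le by (auto simp: A_def le_fun_def intro!: bexI[of _ u])
  qed
  from predicate_Zorn[OF po this] obtain q where q: "q \<in> A" 
    and min: "\<And>a. a \<in> A \<Longrightarrow> a \<le> q \<Longrightarrow> a = q" by blast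
  have sq: "sublinear q" and qp: "q x \<le> p x" for x using q by (auto simp: A_def le_fun_def)
  have sup: "q x + q v \<le> q (x + v)" for x v
  proof -
    obtain s where s: "sublinear s" "\<And>x. s x \<le> q x" "\<And>x. s x \<le> q (x + v) - q v"
      by (rule sublinear_improve[OF sq, of v]) blast
    have "s = q"
      using s qp by (intro min) (auto simp: A_def le_fun_def intro: order_trans)
    with s(3)[of x] show ?thesis by simp
  qed
  have add: "q (x + y) = q x + q y" for x y
    using sup[of x y] sublinear_add[OF sq, of x y] by simp
  have neg: "q (- x) = - q x" for x
    using add[of x "- x"] sublinear_zero[OF sq] by simp
  have "q (c *\<^sub>R x) = c * q x" for c x
    using sublinear_scaleR[OF sq, of c x] sublinear_scaleR[OF sq, of "- c" x] neg[of "c *\<^sub>R x"]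
    by (cases "c \<ge> 0") auto
  with add have "linear q" by (intro linearI) auto
  with qp show ?thesis by (intro that)
qed

section \<open>Complex functionals from real ones\<close>

definition complex_functional :: "('a::complex_normed_vector \<Rightarrow> complex) \<Rightarrow> bool" where
  "complex_functional \<psi> \<longleftrightarrow> bounded_linear \<psi> \<and> (\<forall>c x. \<psi> (c *\<^sub>C x) = c * \<psi> x)"

text \<open>Improving the norm in direction \<open>y\<close> first forces every linear minorant to be at least
  \<open>norm y\<close> at \<open>y\<close>; the complex functional is $\psi(x) = \varphi(x) - i\varphi(ix)$.\<close>

lemma hahn_banach_norming:
  fixes y :: "'a::complex_normed_vector"
  obtains \<psi> where "complex_functional \<psi>" "\<And>x. cmod (\<psi> x) \<le> norm x" "\<psi> y = of_real (norm y)"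
proof -
  have "sublinear (norm :: 'a \<Rightarrow> real)" by (auto simp: sublinear_def norm_triangle_ineq)
  then obtain p :: "'a \<Rightarrow> real" where p: "sublinear p" "\<And>x. p x \<le> norm x" 
    "\<And>x. p x \<le> norm (x + y) - norm y" by (rule sublinear_improve[where v = y]) blast
  obtain \<phi> where \<phi>: "linear \<phi>" "\<And>x. \<phi> x \<le> p x" using hahn_banach_sublinear[OF p(1)] by blast
  have le: "\<phi> x \<le> norm x" for x using \<phi>(2)[of x] p(2)[of x] by simp
  have y: "\<phi> y = norm y"
    using \<phi>(2)[of "- y"] p(3)[of "- y"] le[of y] linear_neg[OF \<phi>(1), of y] by simp
  define \<psi> where "\<psi> x = Complex (\<phi> x) (- \<phi> (\<i> *\<^sub>C x))" for x
  have add: "\<psi> (a + b) = \<psi> a + \<psi> b" for a b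
    by (simp add: \<psi>_def complex_eq_iff scaleC_add_right linear_add[OF \<phi>(1)])
  have real: "\<psi> (of_real r *\<^sub>C x) = of_real r * \<psi> x" for r x
  proof -
    have "\<i> *\<^sub>C (of_real r *\<^sub>C x) = r *\<^sub>R (\<i> *\<^sub>C x)"
      by (metis scaleC_of_real scaleC_scaleC mult.commute)
    then show ?thesis 
      by (simp add: \<psi>_def complex_eq_iff scaleC_of_real linear_scale[OF \<phi>(1)])
  qed
  have imag: "\<psi> (\<i> *\<^sub>C x) = \<i> * \<psi> x" for x
  proof -
    have "\<i> *\<^sub>C (\<i> *\<^sub>C x) = - x"
      using scaleC_of_real[of "-1" x] by (simp add: scaleC_scaleC)
    then show ?thesis by (simp add: \<psi>_def complex_eq_iff linear_neg[OF \<phi>(1)])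
  qed
  have scale: "\<psi> (c *\<^sub>C x) = c * \<psi> x" for c x
  proof -
    have "c *\<^sub>C x = of_real (Re c) *\<^sub>C x + \<i> *\<^sub>C (of_real (Im c) *\<^sub>C x)"
      by (simp add: scaleC_scaleC flip: scaleC_add_left complex_eq)
    then have "\<psi> (c *\<^sub>C x) = (of_real (Re c) + \<i> * of_real (Im c)) * \<psi> x"
      by (simp add: add real imag algebra_simps)
    then show ?thesis by (simp flip: complex_eq)
  qed
  have bound: "cmod (\<psi> x) \<le> norm x" for x
  proof (cases "\<psi> x = 0")
    case False
    \<comment> \<open>A unimodular factor that rotates \<open>\<psi> x\<close> onto the positive
      real axis, where \<open>\<psi>\<close> agrees with its real part
      \<open>\<phi>\<close>.\<close>
    define c where "c = cnj (\<psi> x) / cmod (\<psi> x)"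
    have "\<psi> (c *\<^sub>C x) = of_real (cmod (\<psi> x))"
      using False by (simp add: scale c_def mult.commute[of "cnj _"] complex_norm_square[symmetric] power2_eq_square)
    then have "cmod (\<psi> x) = \<phi> (c *\<^sub>C x)" by (simp add: \<psi>_def complex_eq_iff)
    also have "\<dots> \<le> norm (c *\<^sub>C x)" by (rule le)
    also have "\<dots> = norm x" using False by (simp add: norm_scaleC c_def norm_divide)
    finally show ?thesis .
  qed simp
  have "bounded_linear \<psi>"
  proof (rule bounded_linear_intro[of _ 1])
    show "\<psi> (r *\<^sub>R x) = r *\<^sub>R \<psi> x" for r x
      using real[of r x] by (simp add: scaleC_of_real scaleR_conv_of_real)
  qed (use add bound in auto)
  with scale have cf: "complex_functional \<psi>" by (simp add: complex_functional_def)
  \<comment> \<open>The real part of \<open>\<psi> y\<close> already exhausts the bound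
    \<open>norm y\<close>, so the imaginary part vanishes.\<close>
  have "\<psi> y = of_real (norm y)"
  proof -
    have "(norm y)\<^sup>2 + (\<phi> (\<i> *\<^sub>C y))\<^sup>2 \<le> (norm y)\<^sup>2"
      using power_mono[OF bound[of y], of 2] by (simp add: \<psi>_def y cmod_power2)
    then show ?thesis by (simp add: \<psi>_def y complex_eq_iff)
  qed
  with cf bound show ?thesis by (rule that)
qed

lemma complex_functionals_separate:
  fixes x y :: "'a::complex_normed_vector"
  assumes "\<And>\<psi>. complex_functional \<psi> \<Longrightarrow> \<psi> x = \<psi> y"
  shows "x = y"
proof -
  obtain \<psi> where \<psi>: "complex_functional \<psi>" "\<psi> (x - y) = of_real (norm (x - y))"
    by (rule hahn_banach_norming)
  then show ?thesis 
    using assms[OF \<psi>(1)] by (simp add: complex_functional_def linear_diff bounded_linear.linear)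
qed

section \<open>Three lines theorem\<close>

lemma complex_functional_differentiable:
  assumes \<psi>: "complex_functional \<psi>" and f: "(f has_derivative (\<lambda>h. h *\<^sub>C v)) (at z)"
  shows "(\<lambda>w. \<psi> (f w)) field_differentiable at z"
proof -
  have bl: "bounded_linear \<psi>" and sc: "\<And>c x. \<psi> (c *\<^sub>C x) = c * \<psi> x"
    using \<psi> by (auto simp: complex_functional_def)
  have "((\<lambda>w. \<psi> (f w)) has_derivative (\<lambda>h. \<psi> (h *\<^sub>C v))) (at z)"
    by (rule bounded_linear.has_derivative[OF bl f])
  then have "((\<lambda>w. \<psi> (f w)) has_field_derivative \<psi> v) (at z)"
    by (simp add: has_field_derivative_def sc mult.commute[of _ "\<psi> v"] mult_commute_abs)
  then show ?thesis by (auto simp: field_differentiable_def)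
qed

text \<open>A Gaussian factor damps \<open>g\<close> at height, which reduces the claim to the
  maximum principle on a rectangle; then the damping tends to zero. Positivity of \<open>M\<close>
  lets the damped values on the horizontal sides fall below \<open>M\<close>.\<close>

lemma three_lines_scalar:
  fixes g :: "complex \<Rightarrow> complex"
  assumes hol: "g holomorphic_on open_strip" and cont: "continuous_on strip g"
    and B: "\<And>z. z \<in> strip \<Longrightarrow> cmod (g z) \<le> B"
    and M: "M > 0" "\<And>z. Re z = 0 \<or> Re z = 1 \<Longrightarrow> cmod (g z) \<le> M"
    and z: "z \<in> strip"
  shows "cmod (g z) \<le> M"
proof -
  have damped: "cmod (g z * exp (of_real \<epsilon> * (z\<^sup>2 - 1))) \<le> M" if \<epsilon>: "\<epsilon> > 0" for \<epsilon>
  proof -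
    \<comment> \<open>The shift by -1 makes the factor at most 1 in modulus on the whole strip,
      where the square of the real part is at most 1; so the bound on the vertical lines
      survives.\<close>
    define k where "k w = g w * exp (of_real \<epsilon> * (w\<^sup>2 - 1))" for w
    have nk: "cmod (k w) \<le> cmod (g w) * exp (- \<epsilon> * (Im w)\<^sup>2)" if w: "w \<in> strip" for w
    proof -
      have "(Re w)\<^sup>2 \<le> 1" using w by (simp add: strip_def power_le_one)
      then have "\<epsilon> * ((Re w)\<^sup>2 - (Im w)\<^sup>2 - 1) \<le> - \<epsilon> * (Im w)\<^sup>2"
        using \<epsilon> by (simp add: algebra_simps)
      then show ?thesis
        by (auto simp: k_def norm_mult norm_exp_eq_Re power2_eq_square intro!: mult_left_mono)
    qed
    have "((\<lambda>y. B * exp (- \<epsilon> * y\<^sup>2)) \<longlongrightarrow> 0) at_top"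
      using \<epsilon> by real_asymp
    then have "\<forall>\<^sub>F y in at_top. B * exp (- \<epsilon> * y\<^sup>2) < M"
      using M(1) by (rule order_tendstoD)
    then have "\<forall>\<^sub>F y in at_top. B * exp (- \<epsilon> * y\<^sup>2) < M \<and> y > \<bar>Im z\<bar>"
      by (intro eventually_conj eventually_gt_at_top)
    then obtain Y where Y: "B * exp (- \<epsilon> * Y\<^sup>2) < M" "Y > \<bar>Im z\<bar>"
      by (metis (mono_tags, lifting) eventually_at_top_linorder order_refl)
    define S where "S = cbox (Complex 0 (-Y)) (Complex 1 Y)"
    have int: "interior S \<subseteq> open_strip"
      by (auto simp: S_def interior_cbox in_box_complex_iff open_strip_def)
    have SS: "S \<subseteq> strip" by (auto simp: S_def in_cbox_complex_iff strip_def)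
    have "cmod (k z) \<le> M"
    proof (rule maximum_modulus_frontier[of k S])
      show "k holomorphic_on interior S"
        unfolding k_def by (intro holomorphic_intros holomorphic_on_subset[OF hol int])
      show "continuous_on (closure S) k"
        unfolding k_def 
        by (intro continuous_intros continuous_on_subset[OF cont]) (use SS in \<open>auto simp: S_def\<close>)
      show "bounded S" by (simp add: S_def)
      show "z \<in> S" using z Y(2) by (auto simp: S_def in_cbox_complex_iff strip_def)
      fix w assume w: "w \<in> frontier S"
      then have wS: "w \<in> strip" using SS frontier_subset_closed[of S] by (auto simp: S_def)
      from w have "(Re w = 0 \<or> Re w = 1) \<or> \<bar>Im w\<bar> = Y"
        by (auto simp: S_def frontier_cbox in_box_complex_iff in_cbox_complex_iff)
      then show "cmod (k w) \<le> M"
      proof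
        assume "Re w = 0 \<or> Re w = 1"
        then have "cmod (g w) * exp (- \<epsilon> * (Im w)\<^sup>2) \<le> M * 1"
          using M \<epsilon> by (intro mult_mono) auto
        with nk[OF wS] show ?thesis by simp
      next
        assume "\<bar>Im w\<bar> = Y"
        then have "(Im w)\<^sup>2 = Y\<^sup>2" by (metis power2_abs)
        then have "cmod (g w) * exp (- \<epsilon> * (Im w)\<^sup>2) \<le> B * exp (- \<epsilon> * Y\<^sup>2)"
          using B[OF wS] by simp
        with nk[OF wS] Y(1) show ?thesis by simp
      qed
    qed
    then show ?thesis by (simp add: k_def)
  qed
  have "((\<lambda>\<epsilon>. cmod (g z * exp (of_real \<epsilon> * (z\<^sup>2 - 1)))) \<longlongrightarrow> cmod (g z * exp (of_real 0 * (z\<^sup>2 - 1)))) (at_right 0)"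
    by (intro tendsto_intros)
  then have lim: "((\<lambda>\<epsilon>. cmod (g z * exp (of_real \<epsilon> * (z\<^sup>2 - 1)))) \<longlongrightarrow> cmod (g z)) (at_right 0)"
    by simp
  show ?thesis
    by (rule tendsto_upperbound[OF lim]) (auto simp: eventually_at_filter intro!: always_eventually damped)
qed

text \<open>A functional norming the single value \<open>f z\<close> turns the claim at
  \<open>z\<close> into the scalar theorem.\<close>

lemma three_lines_vector:
  fixes f :: "complex \<Rightarrow> 'a::complex_normed_vector"
  assumes diff: "\<And>z. z \<in> open_strip \<Longrightarrow> \<exists>v. (f has_derivative (\<lambda>h. h *\<^sub>C v)) (at z)"
    and cont: "continuous_on strip f" and bdd: "bounded (f ` strip)"
    and M: "M > 0" "\<And>z. Re z = 0 \<or> Re z = 1 \<Longrightarrow> norm (f z) \<le> M"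
    and z: "z \<in> strip"
  shows "norm (f z) \<le> M"
proof -
  obtain \<psi> where \<psi>: "complex_functional \<psi>" "\<And>x. cmod (\<psi> x) \<le> norm x" "\<psi> (f z) = of_real (norm (f z))"
    by (rule hahn_banach_norming[of "f z"]) blast
  obtain B where B: "\<And>w. w \<in> strip \<Longrightarrow> norm (f w) \<le> B"
    using bdd by (auto simp: bounded_iff)
  have "open open_strip"
    unfolding open_strip_def
    by (intro open_Collect_conj open_Collect_less continuous_intros)
  moreover have "(\<lambda>w. \<psi> (f w)) field_differentiable at w" if "w \<in> open_strip" for w
    using diff[OF that] complex_functional_differentiable[OF \<psi>(1)] by blast
  ultimately have hol: "(\<lambda>w. \<psi> (f w)) holomorphic_on open_strip"
    by (simp add: holomorphic_on_open field_differentiable_def)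
  have "cmod (\<psi> (f z)) \<le> M"
  proof (rule three_lines_scalar[OF hol])
    show "continuous_on strip (\<lambda>w. \<psi> (f w))"
      using \<psi>(1) cont by (auto simp: complex_functional_def intro: bounded_linear.continuous_on)
    show "cmod (\<psi> (f w)) \<le> B" if "w \<in> strip" for w
      using \<psi>(2)[of "f w"] B[OF that] by simp
    show "cmod (\<psi> (f w)) \<le> M" if "Re w = 0 \<or> Re w = 1" for w
      using \<psi>(2)[of "f w"] M(2)[OF that] by simp
  qed (use M z in auto)
  with \<psi>(3) show ?thesis by simp
qed

section \<open>Point evaluations representing an increment\<close>

text \<open>Orthogonality of the characters of a cyclic group: the summands are the powers of one
  root of unity \<open>u\<close>, and a full geometric sum vanishes unless
  \<open>u = 1\<close>.\<close>

lemma sum_roots_of_unity: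
  assumes "m < N" "n < N"
  defines "\<omega> \<equiv> \<lambda>j. cis (2 * pi * real j / real N)"
  shows "(\<Sum>j<N. \<omega> j ^ m / \<omega> j ^ n) = (if m = n then of_nat N else 0)"
proof -
  have N: "N > 0" using assms by auto
  define u where "u = cis (2 * pi * (real m - real n) / real N)"
  have eq: "\<omega> j ^ m / \<omega> j ^ n = u ^ j" for j
  proof -
    have "\<omega> j ^ m / \<omega> j ^ n = cis (real m * (2 * pi * real j / real N) - real n * (2 * pi * real j / real N))"
      by (simp only: \<omega>_def Complex.DeMoivre cis_divide)
    also have "\<dots> = cis (real j * (2 * pi * (real m - real n) / real N))"
      by (rule arg_cong[of _ _ cis]) (simp add: left_diff_distrib right_diff_distrib diff_divide_distrib mult_ac)
    also have "\<dots> = u ^ j" unfolding u_def by (rule Complex.DeMoivre[symmetric])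
    finally show ?thesis .
  qed
  show ?thesis
  proof (cases "m = n")
    case True
    then show ?thesis unfolding eq by (simp add: u_def)
  next
    case False
    \<comment> \<open>Otherwise \<open>N\<close> would divide the nonzero difference of
      \<open>m\<close> and \<open>n\<close>, which is smaller than \<open>N\<close> in absolute
      value.\<close>
    have "u \<noteq> 1"
    proof
      assume "u = 1"
      then have "cos (2 * pi * (real m - real n) / real N) = 1"
        unfolding u_def by (simp add: complex_eq_iff)
      then obtain k :: int where "2 * pi * (real m - real n) / real N = of_int k * 2 * pi"
        by (auto simp: cos_one_2pi_int)
      then have "(2 * pi) * (real m - real n) = (2 * pi) * (of_int k * real N)"
        using N by (simp add: field_simps)
      then have "real m - real n = of_int k * real N" by simp
      then have "real_of_int (int m - int n) = real_of_int (k * int N)" by simp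
      then have k: "int m - int n = k * int N" unfolding of_int_eq_iff .
      then have "k \<noteq> 0" using False by auto
      then have "1 * int N \<le> \<bar>k\<bar> * int N" by (intro mult_right_mono) auto
      moreover have "\<bar>int m - int n\<bar> < int N" using assms by auto
      ultimately show False using k by (simp add: abs_mult)
    qed
    moreover have "u ^ N = 1"
    proof -
      have "u ^ N = cis (2 * pi * of_int (int m - int n))" 
        unfolding u_def Complex.DeMoivre using N by (intro arg_cong[of _ _ cis]) simp
      then show ?thesis by (simp add: cis_multiple_2pi del: of_int_diff)
    qed
    ultimately have "(\<Sum>j<N. u ^ j) = 0" by (simp add: sum_gp_strict)
    with False show ?thesis by (simp add: eq)
  qed
qed

text \<open>A sequence \<open>l\<close> stands for the functional $\sum_n a_n w^n \mapsto \sum_n l_n a_n$; it is split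
  into a combination of point evaluations of mass at most \<open>m\<close> and a remainder \<open>l'\<close>.\<close>

definition moment_split ::
    "real \<Rightarrow> nat \<Rightarrow> (nat \<Rightarrow> complex) \<Rightarrow> (nat \<Rightarrow> complex) \<Rightarrow> (nat \<Rightarrow> complex) \<Rightarrow> (nat \<Rightarrow> complex) \<Rightarrow> bool" where
  "moment_split m N \<mu> p l l' \<longleftrightarrow> (\<forall>j<N. cmod (p j) < 1) \<and> (\<Sum>j<N. cmod (\<mu> j)) \<le> m \<and>
     (\<forall>n. l n = (\<Sum>j<N. \<mu> j * p j ^ n) + l' n)"

text \<open>Sampling at the \<open>N\<close>-th roots of unity on a circle of radius strictly between \<open>r\<close> and \<open>r'\<close>
  reproduces the first \<open>N\<close> moments, so the remainder starts at order \<open>N\<close> and is tiny when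
  measured at the larger radius \<open>r'\<close>.\<close>

lemma moment_split_step:
  fixes r r' :: real
  assumes r: "0 < r" "r < r'" "r' < 1"
  obtains \<kappa> where "\<kappa> \<ge> 1"
    "\<And>\<epsilon> A l. \<epsilon> > 0 \<Longrightarrow> (\<And>n. cmod (l n) \<le> A * r ^ n) \<Longrightarrow>
       \<exists>N \<mu> p l'. moment_split (\<kappa> * A) N \<mu> p l l' \<and> (\<forall>n. cmod (l' n) \<le> \<epsilon> * A * r' ^ n)"
proof -
  define \<rho> where "\<rho> = (r + r') / 2"
  have \<rho>: "r < \<rho>" "\<rho> < r'" "0 < \<rho>" "\<rho> < 1" using r by (auto simp: \<rho>_def)
  \<comment> \<open>The sum of the geometric series in \<open>r / \<rho>\<close>, which bounds the
    weights below. It is fixed before \<open>\<epsilon>\<close>, \<open>A\<close> and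
    \<open>l\<close>, so that the accuracy can later be adapted to it.\<close>
  define \<kappa> where "\<kappa> = 1 / (1 - r / \<rho>)"
  have q: "0 < r / \<rho>" "r / \<rho> < 1" using r \<rho> by auto
  then have \<kappa>: "\<kappa> \<ge> 1" by (simp add: \<kappa>_def)
  have "\<exists>N \<mu> p l'. moment_split (\<kappa> * A) N \<mu> p l l' \<and> (\<forall>n. cmod (l' n) \<le> \<epsilon> * A * r' ^ n)"
    if \<epsilon>: "\<epsilon> > 0" and l: "\<And>n. cmod (l n) \<le> A * r ^ n" for \<epsilon> A and l :: "nat \<Rightarrow> complex"
  proof -
    have A: "A \<ge> 0" using l[of 0] norm_ge_zero[of "l 0"] by (simp del: norm_ge_zero)
    have "(\<lambda>N. (1 + \<kappa>) * (\<rho> / r') ^ N) \<longlonglongrightarrow> (1 + \<kappa>) * 0"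
      using \<rho> by (intro tendsto_intros LIMSEQ_power_zero) auto
    then have "\<forall>\<^sub>F N in sequentially. (1 + \<kappa>) * (\<rho> / r') ^ N < \<epsilon>"
      using \<epsilon> by (intro order_tendstoD) auto
    then obtain N where N: "(1 + \<kappa>) * (\<rho> / r') ^ N < \<epsilon>" "N > 0"
      using eventually_conj[OF _ eventually_gt_at_top[of "0::nat"]]
      by (metis (mono_tags, lifting) eventually_happens' trivial_limit_sequentially)
    define \<omega> where "\<omega> j = cis (2 * pi * real j / real N)" for j
    define p where "p j = of_real \<rho> * \<omega> j" for j
    \<comment> \<open>The discrete Fourier inversion of the first \<open>N\<close> moments:
      orthogonality of the roots of unity returns \<open>l m\<close> for every
      \<open>m < N\<close>.\<close>
    define \<mu> where "\<mu> j = (\<Sum>n<N. l n / p j ^ n) / of_nat N" for j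
    have np: "cmod (p j) = \<rho>" for j using \<rho> by (simp add: p_def \<omega>_def norm_mult)
    have mu: "cmod (\<mu> j) \<le> \<kappa> * A / N" for j
    proof -
      have "cmod (\<Sum>n<N. l n / p j ^ n) \<le> (\<Sum>n<N. A * (r / \<rho>) ^ n)"
        using \<rho> l by (intro sum_norm_le) (simp add: norm_divide norm_power np power_divide divide_right_mono)
      also have "\<dots> = A * (\<Sum>n<N. (r / \<rho>) ^ n)" by (simp add: sum_distrib_left)
      also have "\<dots> \<le> A * \<kappa>"
      proof (rule mult_left_mono[OF _ A])
        have "(\<Sum>n<N. (r / \<rho>) ^ n) \<le> (\<Sum>n. (r / \<rho>) ^ n)"
          using q by (intro sum_le_suminf summable_geometric) auto
        then show "(\<Sum>n<N. (r / \<rho>) ^ n) \<le> \<kappa>" using q by (simp add: \<kappa>_def suminf_geometric)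
      qed
      finally have "cmod (\<Sum>n<N. l n / p j ^ n) \<le> \<kappa> * A"
        by (simp add: mult.commute)
      then show ?thesis by (simp add: \<mu>_def norm_divide divide_right_mono)
    qed
    have mass: "(\<Sum>j<N. cmod (\<mu> j)) \<le> \<kappa> * A"
      using sum_mono[of "{..<N}" "\<lambda>j. cmod (\<mu> j)" "\<lambda>_. \<kappa> * A / N", OF mu] N(2) by simp
    have low: "(\<Sum>j<N. \<mu> j * p j ^ m) = l m" if m: "m < N" for m
    proof -
      have "(\<Sum>j<N. \<mu> j * p j ^ m) = (\<Sum>j<N. \<Sum>n<N. l n * of_real \<rho> ^ m / of_real \<rho> ^ n * (\<omega> j ^ m / \<omega> j ^ n)) / of_nat N"
        by (simp add: \<mu>_def sum_divide_distrib sum_distrib_right sum_distrib_left p_def power_mult_distrib field_simps)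
      also have "(\<Sum>j<N. \<Sum>n<N. l n * of_real \<rho> ^ m / of_real \<rho> ^ n * (\<omega> j ^ m / \<omega> j ^ n))
          = (\<Sum>n<N. l n * of_real \<rho> ^ m / of_real \<rho> ^ n * (\<Sum>j<N. \<omega> j ^ m / \<omega> j ^ n))"
        by (subst sum.swap) (simp add: sum_distrib_left)
      also have "\<dots> = (\<Sum>n<N. if m = n then l n * of_nat N else 0)"
        using \<rho> m by (intro sum.cong refl) (auto simp: sum_roots_of_unity \<omega>_def)
      also have "\<dots> = l m * of_nat N" using m by simp
      finally show ?thesis using N(2) by simp
    qed
    have "cmod (l n - (\<Sum>j<N. \<mu> j * p j ^ n)) \<le> \<epsilon> * A * r' ^ n" for n
    proof (cases "n < N")
      case True
      then show ?thesis using low \<epsilon> A r by simp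
    next
      case False
      have "cmod (\<Sum>j<N. \<mu> j * p j ^ n) \<le> (\<Sum>j<N. cmod (\<mu> j) * \<rho> ^ n)"
        by (intro sum_norm_le) (simp add: norm_mult norm_power np)
      also have "\<dots> \<le> \<kappa> * A * \<rho> ^ n"
        using mass \<rho> by (simp flip: sum_distrib_right add: mult_right_mono)
      finally have "cmod (l n - (\<Sum>j<N. \<mu> j * p j ^ n)) \<le> A * r ^ n + \<kappa> * A * \<rho> ^ n"
        using l[of n] norm_triangle_ineq4[of "l n" "\<Sum>j<N. \<mu> j * p j ^ n"] by simp
      also have "\<dots> \<le> A * \<rho> ^ n + \<kappa> * A * \<rho> ^ n"
        using A r \<rho> by (intro add_right_mono mult_left_mono power_mono) auto
      also have "\<dots> = (1 + \<kappa>) * (\<rho> / r') ^ n * A * r' ^ n"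
        using r by (simp add: power_divide field_simps)
      also have "\<dots> \<le> ((1 + \<kappa>) * (\<rho> / r') ^ N) * A * r' ^ n"
        using A r \<rho> \<kappa> False by (intro mult_right_mono mult_left_mono power_decreasing) auto
      also have "\<dots> \<le> \<epsilon> * A * r' ^ n"
        using A r N(1) by (intro mult_right_mono) auto
      finally show ?thesis .
    qed
    moreover have "moment_split (\<kappa> * A) N \<mu> p l (\<lambda>n. l n - (\<Sum>j<N. \<mu> j * p j ^ n))"
      using mass np \<rho> by (simp add: moment_split_def)
    ultimately show ?thesis by blast
  qed
  with \<kappa> show ?thesis by (rule that)
qed

text \<open>The points come in finite blocks because each stage of the construction yields one
  block; the block masses decay geometrically, which makes the vector series absolutely convergent.
  Holomorphy on a disc of radius 2 gives absolutely summable Taylor coefficients, needed because the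
  points may approach the unit circle.\<close>

definition increment_representation ::
    "real \<Rightarrow> complex \<Rightarrow> (nat \<Rightarrow> nat) \<Rightarrow> (nat \<Rightarrow> nat \<Rightarrow> complex) \<Rightarrow> (nat \<Rightarrow> nat \<Rightarrow> complex) \<Rightarrow> bool" where
  "increment_representation K z N \<mu> p \<longleftrightarrow>
      (\<forall>i j. j < N i \<longrightarrow> cmod (p i j) < 1) \<and>
      (\<forall>i. (\<Sum>j<N i. cmod (\<mu> i j)) \<le> K * cmod z * (1/2) ^ i) \<and>
      (\<forall>g. g holomorphic_on ball 0 2 \<longrightarrow> (\<lambda>i. \<Sum>j<N i. \<mu> i j * g (p i j)) sums (g z - g 0))"

text \<open>The step is iterated along radii increasing to 1; the accuracy at stage \<open>i\<close> is chosen to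
  absorb the constant \<open>\<kappa> (Suc i)\<close> of the next stage.\<close>

lemma increment_representation_exists:
  obtains K :: real where "K > 0"
    "\<And>z. cmod z \<le> 1 / 2 \<Longrightarrow> \<exists>N \<mu> p. increment_representation K z N \<mu> p"
proof -
  \<comment> \<open>\<open>r 0\<close> is 1/2, which matches the restriction on
    \<open>z\<close>.\<close>
  define r :: "nat \<Rightarrow> real" where "r i = 1 - (1/2) ^ Suc i" for i
  have r: "0 < r i" "r i < r (Suc i)" "r i < 1" for i
  proof -
    have "(1/2::real) ^ i > 0" "(1/2::real) ^ i \<le> 1" by (auto simp: power_le_one)
    then show "0 < r i" "r i < r (Suc i)" "r i < 1" unfolding r_def power_Suc by linarith+
  qed
  have "\<exists>\<kappa>\<ge>1. \<forall>\<epsilon> A l. \<epsilon> > 0 \<longrightarrow> (\<forall>n. cmod (l n) \<le> A * r i ^ n) \<longrightarrow>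
       (\<exists>N \<mu> p l'. moment_split (\<kappa> * A) N \<mu> p l l' \<and> (\<forall>n. cmod (l' n) \<le> \<epsilon> * A * r (Suc i) ^ n))" for i
    by (rule moment_split_step[of "r i" "r (Suc i)"]) (use r in blast)+
  then obtain \<kappa> where \<kappa>: "\<And>i. \<kappa> i \<ge> 1" and
    step: "\<And>i \<epsilon> A l. \<epsilon> > 0 \<Longrightarrow> (\<forall>n. cmod (l n) \<le> A * r i ^ n) \<Longrightarrow>
       \<exists>N \<mu> p l'. moment_split (\<kappa> i * A) N \<mu> p l l' \<and> (\<forall>n. cmod (l' n) \<le> \<epsilon> * A * r (Suc i) ^ n)"
    by metis
  have \<kappa>pos: "\<kappa> i > 0" for i using \<kappa>[of i] by linarith
  have "\<exists>N \<mu> p. increment_representation (2 * \<kappa> 0) z N \<mu> p"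
    if z: "cmod z \<le> 1 / 2" for z
  proof -
    \<comment> \<open>Chosen so that the mass \<open>\<kappa> i * A i\<close> of stage
      \<open>i\<close> is \<open>2 * \<kappa> 0 * cmod z * (1/2) ^ i\<close>.\<close>
    define A where "A i = 2 * cmod z * \<kappa> 0 / \<kappa> i * (1/2) ^ i" for i
    let ?z = "\<lambda>n. if n = 0 then 0 else z ^ n"
    have "\<exists>f. \<forall>i. ((\<forall>n. cmod (f i n) \<le> A i * r i ^ n) \<and> (i = 0 \<longrightarrow> f i = ?z)) \<and>
            (\<exists>N \<mu> p. moment_split (\<kappa> i * A i) N \<mu> p (f i) (f (Suc i)))"
    proof (rule dependent_nat_choice)
      have "cmod (?z n) \<le> A 0 * r 0 ^ n" for n
      proof (cases n)
        case (Suc k)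
        have "cmod (z ^ n) = cmod z * cmod z ^ k" by (simp add: Suc norm_mult norm_power)
        also have "\<dots> \<le> cmod z * (1/2) ^ k" using z by (intro mult_left_mono power_mono) auto
        also have "\<dots> = A 0 * r 0 ^ n" using \<kappa>pos[of 0] by (simp add: A_def r_def Suc)
        finally show ?thesis using Suc by simp
      qed (use \<kappa>pos[of 0] in \<open>simp add: A_def\<close>)
      then show "\<exists>x. (\<forall>n. cmod (x n) \<le> A 0 * r 0 ^ n) \<and> ((0::nat) = 0 \<longrightarrow> x = ?z)"
        by (intro exI[of _ ?z]) simp
    next
      fix l i assume "(\<forall>n. cmod (l n) \<le> A i * r i ^ n) \<and> (i = 0 \<longrightarrow> l = ?z)"
      then have l: "\<forall>n. cmod (l n) \<le> A i * r i ^ n" by blast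
      \<comment> \<open>The accuracy that turns \<open>A i\<close> into
        \<open>A (Suc i)\<close>.\<close>
      define \<epsilon> where "\<epsilon> = \<kappa> i / \<kappa> (Suc i) / 2"
      have "\<epsilon> > 0" using \<kappa>pos by (simp add: \<epsilon>_def)
      from step[OF this l] obtain N \<mu> p l' where
        *: "moment_split (\<kappa> i * A i) N \<mu> p l l'" "\<forall>n. cmod (l' n) \<le> \<epsilon> * A i * r (Suc i) ^ n" by blast
      have "\<epsilon> * A i = A (Suc i)" using \<kappa>pos[of i] by (simp add: \<epsilon>_def A_def)
      with * show "\<exists>l'. ((\<forall>n. cmod (l' n) \<le> A (Suc i) * r (Suc i) ^ n) \<and> (Suc i = 0 \<longrightarrow> l' = ?z)) \<and>
            (\<exists>N \<mu> p. moment_split (\<kappa> i * A i) N \<mu> p l l')"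
        by (intro exI[of _ l']) auto
    qed
    then obtain \<Lambda> where \<Lambda>: "\<And>i n. cmod (\<Lambda> i n) \<le> A i * r i ^ n" "\<Lambda> 0 = ?z"
      "\<And>i. \<exists>N \<mu> p. moment_split (\<kappa> i * A i) N \<mu> p (\<Lambda> i) (\<Lambda> (Suc i))" by blast
    from \<Lambda>(3) obtain N \<mu> p where J: "\<And>i. moment_split (\<kappa> i * A i) (N i) (\<mu> i) (p i) (\<Lambda> i) (\<Lambda> (Suc i))" by metis
    have pp: "cmod (p i j) < 1" if "j < N i" for i j using J[of i] that by (auto simp: moment_split_def)
    have mass: "(\<Sum>j<N i. cmod (\<mu> i j)) \<le> (2 * \<kappa> 0) * cmod z * (1/2) ^ i" for i
    proof -
      have "\<kappa> i * A i = (2 * \<kappa> 0) * cmod z * (1/2) ^ i" using \<kappa>pos[of i] by (simp add: A_def)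
      then show ?thesis using J[of i] by (simp add: moment_split_def)
    qed
    have rec: "\<Lambda> i n = (\<Sum>j<N i. \<mu> i j * p i j ^ n) + \<Lambda> (Suc i) n" for i n
      using J[of i] by (simp add: moment_split_def)
    have "(\<lambda>i. \<Sum>j<N i. \<mu> i j * g (p i j)) sums (g z - g 0)" if g: "g holomorphic_on ball 0 2" for g
    proof -
      define a where "a n = (deriv ^^ n) g 0 / fact n" for n
      have ser: "(\<lambda>n. a n * w ^ n) sums g w" if "cmod w < 2" for w
        using holomorphic_power_series[OF g, of w] that by (simp add: a_def)
      have sa: "summable (\<lambda>n. cmod (a n))"
      proof -
        have "summable (\<lambda>n. norm (a n * 1 ^ n))"
        proof (rule powser_insidea)
          show "summable (\<lambda>n. a n * (3/2) ^ n)" by (rule sums_summable[OF ser]) simp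
        qed simp
        then show ?thesis by simp
      qed
      have A0: "A i \<ge> 0" for i using \<kappa>pos by (simp add: A_def less_imp_le)
      have bd: "cmod (\<Lambda> i n * a n) \<le> A i * cmod (a n)" for i n
      proof -
        have "cmod (\<Lambda> i n) \<le> A i * r i ^ n" by (rule \<Lambda>)
        also have "\<dots> \<le> A i * 1" using r A0 by (intro mult_left_mono power_le_one) (auto simp: less_imp_le)
        finally show ?thesis by (simp add: norm_mult mult_right_mono)
      qed
      have sm: "summable (\<lambda>n. \<Lambda> i n * a n)" "summable (\<lambda>n. cmod (\<Lambda> i n * a n))" for i
        by (rule summable_comparison_test[OF _ summable_mult[OF sa, of "A i"]], use bd in auto)+
      \<comment> \<open>The remainder after \<open>i\<close> stages, applied to \<open>g\<close>.
        Each block is a difference of consecutive remainders, so the series telescopes once they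
        tend to 0.\<close>
      define T where "T i = (\<Sum>n. \<Lambda> i n * a n)" for i
      have T0: "T 0 = g z - g 0"
      proof -
        have "(\<lambda>n. a n * z ^ n - a n * 0 ^ n) sums (g z - g 0)"
          using z by (intro sums_diff ser) auto
        \<comment> \<open>Since \<open>0 ^ 0 = 1\<close>, subtracting the series at 0 removes
          exactly the zeroth coefficient, as \<open>\<Lambda> 0\<close> does.\<close>
        moreover have "(\<lambda>n. a n * z ^ n - a n * 0 ^ n) = (\<lambda>n. \<Lambda> 0 n * a n)"
          by (auto simp: \<Lambda>(2) fun_eq_iff)
        ultimately show ?thesis by (simp add: T_def sums_iff)
      qed
      have TS: "(\<Sum>j<N i. \<mu> i j * g (p i j)) = T i - T (Suc i)" for i
      proof -
        have "(\<lambda>n. \<Sum>j<N i. \<mu> i j * (a n * p i j ^ n)) sums (\<Sum>j<N i. \<mu> i j * g (p i j))"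
          using pp by (intro sums_sum sums_mult ser) force
        moreover have "(\<Sum>j<N i. \<mu> i j * (a n * p i j ^ n)) = \<Lambda> i n * a n - \<Lambda> (Suc i) n * a n" for n
          by (simp add: rec[of i] sum_distrib_right sum_distrib_left algebra_simps)
        moreover have "(\<lambda>n. \<Lambda> i n * a n - \<Lambda> (Suc i) n * a n) sums (T i - T (Suc i))"
          unfolding T_def by (intro sums_diff summable_sums sm)
        ultimately show ?thesis by (simp add: sums_iff)
      qed
      have Tb: "cmod (T i) \<le> (2 * cmod z * \<kappa> 0 * (\<Sum>n. cmod (a n))) * (1/2) ^ i" for i
      proof -
        have "cmod (T i) \<le> (\<Sum>n. cmod (\<Lambda> i n * a n))"
          unfolding T_def by (rule summable_norm[OF sm(2)])
        also have "\<dots> \<le> (\<Sum>n. A i * cmod (a n))"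
          by (intro suminf_le bd sm summable_mult sa)
        also have "\<dots> = A i * (\<Sum>n. cmod (a n))" by (rule suminf_mult[OF sa])
        also have "A i \<le> 2 * cmod z * \<kappa> 0 * (1/2) ^ i"
        proof -
          have "2 * cmod z * \<kappa> 0 / \<kappa> i \<le> 2 * cmod z * \<kappa> 0 / 1"
            using \<kappa>[of i] \<kappa>pos[of 0] by (intro divide_left_mono) auto
          then show ?thesis unfolding A_def by (intro mult_right_mono) auto
        qed
        finally show ?thesis using suminf_nonneg[OF sa] by (simp add: mult_right_mono mult_ac)
      qed
      have "T \<longlonglongrightarrow> 0"
      proof (rule Lim_null_comparison)
        show "\<forall>\<^sub>F i in sequentially. norm (T i) \<le> (2 * cmod z * \<kappa> 0 * (\<Sum>n. cmod (a n))) * (1/2) ^ i"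
          using Tb by simp
        have "(\<lambda>i. (2 * cmod z * \<kappa> 0 * (\<Sum>n. cmod (a n))) * (1/2::real) ^ i) \<longlonglongrightarrow>
            (2 * cmod z * \<kappa> 0 * (\<Sum>n. cmod (a n))) * 0"
          by (intro tendsto_intros LIMSEQ_power_zero) auto
        then show "(\<lambda>i. (2 * cmod z * \<kappa> 0 * (\<Sum>n. cmod (a n))) * (1/2::real) ^ i) \<longlonglongrightarrow> 0" by simp
      qed
      from telescope_sums'[OF this] show ?thesis by (simp add: TS T0)
    qed
    with pp mass have "increment_representation (2 * \<kappa> 0) z N \<mu> p"
      by (simp add: increment_representation_def)
    then show ?thesis by blast
  qed
  moreover have "2 * \<kappa> 0 > 0" using \<kappa>pos[of 0] by simp
  ultimately show ?thesis by (intro that)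
qed

section \<open>Continuity into the embedded space\<close>

lemma bounded_bilinear_scaleC: "bounded_bilinear (scaleC :: complex \<Rightarrow> 'a::complex_normed_vector \<Rightarrow> 'a)"
proof
  fix r :: real and a b :: complex and x y :: 'a
  show "a *\<^sub>C (x + y) = a *\<^sub>C x + a *\<^sub>C y" by (rule scaleC_add_right)
  show "(a + b) *\<^sub>C x = a *\<^sub>C x + b *\<^sub>C x" by (rule scaleC_add_left)
  show "(r *\<^sub>R a) *\<^sub>C x = r *\<^sub>R a *\<^sub>C x"
    by (simp add: scaleR_conv_of_real flip: scaleC_scaleC scaleC_of_real)
  show "a *\<^sub>C r *\<^sub>R x = r *\<^sub>R a *\<^sub>C x"
    by (simp add: scaleC_scaleC mult.commute flip: scaleC_of_real)
  show "\<exists>K. \<forall>a (x::'a). norm (a *\<^sub>C x) \<le> norm a * norm x * K"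
    by (rule exI[of _ 1]) (simp add: norm_scaleC)
qed

lemma scaleC_minus_one: "(-1) *\<^sub>C x = - (x::'a::complex_normed_vector)"
  using scaleC_of_real[of "-1" x] by simp

lemma scaleC_diff_right: "c *\<^sub>C (x - y) = c *\<^sub>C x - c *\<^sub>C (y::'a::complex_normed_vector)"
  by (rule bounded_bilinear.diff_right[OF bounded_bilinear_scaleC])

lemma scaleC_diff_left: "(a - b) *\<^sub>C x = a *\<^sub>C x - b *\<^sub>C (x::'a::complex_normed_vector)"
  by (rule bounded_bilinear.diff_left[OF bounded_bilinear_scaleC])

section \<open>The embedded space as a normed space\<close>

lemma
  assumes "banach_embedded X n"
  shows embedded_zero: "0 \<in> X" and embedded_add: "x \<in> X \<Longrightarrow> y \<in> X \<Longrightarrow> x + y \<in> X"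
    and embedded_scaleC: "x \<in> X \<Longrightarrow> c *\<^sub>C x \<in> X"
    and embedded_norm_nonneg: "x \<in> X \<Longrightarrow> 0 \<le> n x"
    and embedded_norm_eq_0: "x \<in> X \<Longrightarrow> n x = 0 \<longleftrightarrow> x = 0"
    and embedded_norm_add: "x \<in> X \<Longrightarrow> y \<in> X \<Longrightarrow> n (x + y) \<le> n x + n y"
    and embedded_norm_scaleC: "x \<in> X \<Longrightarrow> n (c *\<^sub>C x) = cmod c * n x"
    and embedded_continuous: "\<exists>C. \<forall>x\<in>X. norm x \<le> C * n x"
  using assms by (simp_all add: banach_embedded_def)

lemma embedded_complete:
  assumes X: "banach_embedded X n" and s: "\<And>k. s k \<in> X"
    and Cauchy: "\<And>e. e > 0 \<Longrightarrow> \<exists>N::nat. \<forall>j\<ge>N. \<forall>k\<ge>N. n (s j - s k) < e"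
  shows "\<exists>l\<in>X. \<forall>e>0. \<exists>N. \<forall>k\<ge>N. n (s k - l) < e"
proof -
  have "(\<forall>k. s k \<in> X) \<and> (\<forall>e>0. \<exists>N. \<forall>j\<ge>N. \<forall>k\<ge>N. n (s j - s k) < e)
      \<longrightarrow> (\<exists>l\<in>X. \<forall>e>0. \<exists>N. \<forall>k\<ge>N. n (s k - l) < e)"
    using X unfolding banach_embedded_def by (elim conjE allE[of _ s])
  with s Cauchy show ?thesis by simp
qed

lemma embedded_diff:
  assumes "banach_embedded X n" "x \<in> X" "y \<in> X" shows "x - y \<in> X"
  using embedded_add[OF assms(1,2) embedded_scaleC[OF assms(1,3), of "-1"]] 
  by (simp add: scaleC_minus_one)

lemma embedded_norm_minus:
  assumes "banach_embedded X n" "x \<in> X" shows "n (- x) = n x"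
  using embedded_norm_scaleC[OF assms, of "-1"] by (simp add: scaleC_minus_one)

lemma embedded_norm_diff_commute:
  assumes "banach_embedded X n" "x \<in> X" "y \<in> X" shows "n (x - y) = n (y - x)"
  using embedded_norm_minus[OF assms(1) embedded_diff[OF assms]] by simp

lemma embedded_norm_triangle:
  assumes "banach_embedded X n" "x \<in> X" "y \<in> X" shows "n x \<le> n y + n (x - y)"
  using embedded_norm_add[OF assms(1,3) embedded_diff[OF assms]] by simp

lemma embedded_sum:
  assumes X: "banach_embedded X n" and y: "\<And>i. i \<in> I \<Longrightarrow> y i \<in> X"
  shows "(\<Sum>i\<in>I. y i) \<in> X \<and> n (\<Sum>i\<in>I. y i) \<le> (\<Sum>i\<in>I. n (y i))"
proof -
  have "n 0 = 0" using embedded_norm_eq_0[OF X embedded_zero[OF X]] by simp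
  then show ?thesis using y
  proof (induction I rule: infinite_finite_induct)
    case (insert i I)
    then show ?case
      using embedded_add[OF X, of "y i" "sum y I"] embedded_norm_add[OF X, of "y i" "sum y I"] by auto
  qed (use embedded_zero[OF X] in auto)
qed

text \<open>A substitute for Cauchy's estimate in the embedded norm, for functions that are weakly
  holomorphic only into the ambient space. \<open>K\<close> precedes \<open>f\<close>,
  \<open>M\<close> and \<open>z\<close>, so one constant serves all complex lines.\<close>

lemma embedded_lipschitz_at_0:
  fixes X :: "'h::complex_normed_vector set"
  assumes X: "banach_embedded X n"
  obtains K where "K > 0"
    "\<And>f M z. \<lbrakk>\<And>\<psi>. complex_functional \<psi> \<Longrightarrow> (\<lambda>w. \<psi> (f w)) holomorphic_on ball 0 2;
       \<And>w. cmod w < 1 \<Longrightarrow> f w \<in> X \<and> n (f w) \<le> M; cmod z \<le> 1 / 2\<rbrakk>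
     \<Longrightarrow> n (f z - f 0) \<le> K * cmod z * M"
proof -
  obtain K where K: "K > 0" and rep: "\<And>z. cmod z \<le> 1 / 2 \<Longrightarrow> \<exists>N \<mu> p. increment_representation K z N \<mu> p"
    by (rule increment_representation_exists) blast
  \<comment> \<open>The factor 2 is the sum of the geometric series of block masses.\<close>
  have "n (f z - f 0) \<le> 2 * K * cmod z * M"
    if hol: "\<And>\<psi>. complex_functional \<psi> \<Longrightarrow> (\<lambda>w. \<psi> (f w)) holomorphic_on ball 0 2"
      and f: "\<And>w. cmod w < 1 \<Longrightarrow> f w \<in> X \<and> n (f w) \<le> M" and z: "cmod z \<le> 1 / 2"
    for f :: "complex \<Rightarrow> 'h" and M z
  proof -
    obtain N \<mu> p where "increment_representation K z N \<mu> p" using rep[OF z] by blast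
    then have p: "\<And>i j. j < N i \<Longrightarrow> cmod (p i j) < 1"
      and mass: "\<And>i. (\<Sum>j<N i. cmod (\<mu> i j)) \<le> K * cmod z * (1/2) ^ i"
      and sums: "\<And>g. g holomorphic_on ball 0 2 \<Longrightarrow> (\<lambda>i. \<Sum>j<N i. \<mu> i j * g (p i j)) sums (g z - g 0)"
      by (simp_all add: increment_representation_def)
    have M: "M \<ge> 0" using f[of 0] embedded_norm_nonneg[OF X, of "f 0"] by simp
    define Q where "Q = K * cmod z * M"
    have Q: "Q \<ge> 0" using K M by (simp add: Q_def)
    define y where "y i = (\<Sum>j<N i. \<mu> i j *\<^sub>C f (p i j))" for i
    have y: "y i \<in> X" "n (y i) \<le> Q * (1/2) ^ i" for i
    proof -
      have *: "\<mu> i j *\<^sub>C f (p i j) \<in> X \<and> n (\<mu> i j *\<^sub>C f (p i j)) \<le> cmod (\<mu> i j) * M" if "j \<in> {..<N i}" for j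
        using that f[OF p[of j i]] 
        by (auto simp: embedded_scaleC[OF X] embedded_norm_scaleC[OF X] intro: mult_left_mono)
      have s: "y i \<in> X \<and> n (y i) \<le> (\<Sum>j<N i. n (\<mu> i j *\<^sub>C f (p i j)))"
        unfolding y_def by (rule embedded_sum[OF X]) (use * in blast)
      then show "y i \<in> X" by simp
      have "(\<Sum>j<N i. n (\<mu> i j *\<^sub>C f (p i j))) \<le> (\<Sum>j<N i. cmod (\<mu> i j)) * M"
        using * by (subst sum_distrib_right) (auto intro!: sum_mono)
      also have "\<dots> \<le> (K * cmod z * (1/2) ^ i) * M"
        using mass[of i] M by (intro mult_right_mono)
      finally show "n (y i) \<le> Q * (1/2) ^ i" using s by (simp add: Q_def mult_ac)
    qed
    define S where "S k = (\<Sum>i<k. y i)" for k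
    have SX: "S k \<in> X" for k unfolding S_def using embedded_sum[OF X, of "{..<k}" y] y by simp
    have tail: "n (S k - S j) \<le> 2 * Q * (1/2) ^ j" if "j \<le> k" for j k
    proof -
      have "S k - S j = (\<Sum>i=j..<k. y i)"
        using sum_diff_nat_ivl[of 0 j k y] that by (simp add: S_def lessThan_atLeast0)
      then have "n (S k - S j) \<le> (\<Sum>i=j..<k. n (y i))"
        using embedded_sum[OF X, of "{j..<k}" y] y by simp
      also have "\<dots> \<le> (\<Sum>i=j..<k. Q * (1/2) ^ i)" by (intro sum_mono y)
      also have "\<dots> = 2 * Q * ((1/2) ^ j - (1/2) ^ k)" 
        using that by (induction k rule: dec_induct) (auto simp: algebra_simps)
      also have "\<dots> \<le> 2 * Q * (1/2) ^ j" using Q by (intro mult_left_mono) auto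
      finally show ?thesis .
    qed
    have "\<exists>l\<in>X. \<forall>e>0. \<exists>N. \<forall>k\<ge>N. n (S k - l) < e"
    proof (rule embedded_complete[OF X SX])
      fix e :: real assume e: "e > 0"
      have "(\<lambda>j. 2 * Q * (1/2) ^ j) \<longlonglongrightarrow> 2 * Q * 0"
        by (intro tendsto_intros LIMSEQ_power_zero) auto
      then have "\<forall>\<^sub>F j in sequentially. 2 * Q * (1/2) ^ j < e"
        using e by (intro order_tendstoD) auto
      then obtain L where L: "\<And>j. j \<ge> L \<Longrightarrow> 2 * Q * (1/2) ^ j < e"
        by (auto simp: eventually_sequentially)
      have "n (S j - S k) < e" if "j \<ge> L" "k \<ge> L" for j k
        using tail[of j k] tail[of k j] L[of j] L[of k] that embedded_norm_diff_commute[OF X SX[of j] SX[of k]]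
        by (cases "j \<le> k") auto
      then show "\<exists>N. \<forall>j\<ge>N. \<forall>k\<ge>N. n (S j - S k) < e" by blast
    qed
    then obtain l where l: "l \<in> X" "\<And>e. e > 0 \<Longrightarrow> \<exists>N. \<forall>k\<ge>N. n (S k - l) < e" by blast
    have lim1: "(\<lambda>k. n (S k - l)) \<longlonglongrightarrow> 0"
      using l(2) embedded_norm_nonneg[OF X embedded_diff[OF X SX l(1)]] by (simp add: lim_sequentially)
    have nl: "n l \<le> 2 * Q"
    proof (rule tendsto_lowerbound)
      show "(\<lambda>k. 2 * Q + n (S k - l)) \<longlonglongrightarrow> 2 * Q" using tendsto_add[OF tendsto_const lim1] by simp
      have "n l \<le> 2 * Q + n (S k - l)" for k
        using tail[of 0 k] embedded_norm_triangle[OF X l(1) SX[of k]]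
          embedded_norm_diff_commute[OF X SX[of k] l(1)] by (simp add: S_def)
      then show "\<forall>\<^sub>F k in sequentially. n l \<le> 2 * Q + n (S k - l)" by simp
    qed simp
    \<comment> \<open>The continuous embedding carries the limit over to the ambient norm, in which
      the functionals are continuous.\<close>
    obtain C where C: "\<And>x. x \<in> X \<Longrightarrow> norm x \<le> C * n x" using embedded_continuous[OF X] by blast
    have "(\<lambda>k. S k - l) \<longlonglongrightarrow> 0"
    proof (rule Lim_null_comparison)
      show "\<forall>\<^sub>F k in sequentially. norm (S k - l) \<le> C * n (S k - l)"
        using C[OF embedded_diff[OF X SX l(1)]] by simp
      show "(\<lambda>k. C * n (S k - l)) \<longlonglongrightarrow> 0" using tendsto_mult[OF tendsto_const lim1] by simp
    qed
    then have lim0: "S \<longlonglongrightarrow> l" by (simp add: LIM_zero_iff)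
    have "l = f z - f 0"
    proof (rule complex_functionals_separate)
      fix \<psi> :: "'h \<Rightarrow> complex" assume \<psi>: "complex_functional \<psi>"
      then have bl: "bounded_linear \<psi>" and sc: "\<And>c x. \<psi> (c *\<^sub>C x) = c * \<psi> x"
        by (auto simp: complex_functional_def)
      have lin: "linear \<psi>" using bl by (rule bounded_linear.linear)
      have "(\<lambda>k. \<psi> (S k)) \<longlonglongrightarrow> \<psi> l" by (rule bounded_linear.tendsto[OF bl lim0])
      moreover have "(\<lambda>k. \<psi> (S k)) = (\<lambda>k. \<Sum>i<k. \<Sum>j<N i. \<mu> i j * \<psi> (f (p i j)))"
        by (simp add: S_def y_def linear_sum[OF lin] sc)
      moreover have "\<dots> \<longlonglongrightarrow> \<psi> (f z) - \<psi> (f 0)"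
        using sums[OF hol[OF \<psi>]] by (simp add: sums_def)
      ultimately show "\<psi> l = \<psi> (f z - f 0)"
        by (simp add: LIMSEQ_unique linear_diff[OF lin])
    qed
    with nl show ?thesis by (simp add: Q_def)
  qed
  moreover have "2 * K > 0" using K by simp
  ultimately show ?thesis using that by blast
qed

lemma complex_frechet_differentiable_compose:
  assumes \<Phi>: "complex_frechet_differentiable \<Phi> (f z)" and f: "(f has_derivative (\<lambda>h. h *\<^sub>C v)) (at z)"
  shows "\<exists>w. ((\<lambda>z. \<Phi> (f z)) has_derivative (\<lambda>h. h *\<^sub>C w)) (at z)"
proof -
  obtain L where L: "(\<Phi> has_derivative L) (at (f z))" "\<And>c h. L (c *\<^sub>C h) = c *\<^sub>C L h"
    using \<Phi> by (auto simp: complex_frechet_differentiable_def)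
  have "((\<lambda>z. \<Phi> (f z)) has_derivative (\<lambda>h. h *\<^sub>C L v)) (at z)"
    using diff_chain_at[OF f L(1)] by (simp add: o_def L(2))
  then show ?thesis by blast
qed

text \<open>The Lipschitz estimate is applied on the complex line through \<open>x\<close> and
  \<open>y\<close>, parametrised so that \<open>x\<close> sits at 0 and \<open>y\<close> at distance
  proportional to \<open>n1 (y - x)\<close>.\<close>

lemma embedded_restriction_continuous:
  fixes \<Phi> :: "'e::complex_normed_vector \<Rightarrow> 'h::complex_normed_vector"
  assumes E: "banach_embedded E1 n1" and E_le: "\<forall>x\<in>E1. norm x \<le> n1 x"
    and H: "banach_embedded H1 m1"
    and anal: "\<forall>x\<in>ball 0 R. complex_frechet_differentiable \<Phi> x"
    and bd: "\<And>x. x \<in> E1 \<Longrightarrow> n1 x < R \<Longrightarrow> \<Phi> x \<in> H1 \<and> m1 (\<Phi> x) \<le> M"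
    and x: "x \<in> E1" "n1 x < R" and e: "e > 0"
  obtains d where "d > 0" "\<And>y. y \<in> E1 \<Longrightarrow> n1 (y - x) < d \<Longrightarrow> m1 (\<Phi> y - \<Phi> x) < e"
proof -
  obtain K where K: "K > 0"
    "\<And>f M z. \<lbrakk>\<And>\<psi>. complex_functional \<psi> \<Longrightarrow> (\<lambda>w. \<psi> (f w)) holomorphic_on ball 0 2;
       \<And>w. cmod w < 1 \<Longrightarrow> f w \<in> H1 \<and> m1 (f w) \<le> M; cmod z \<le> 1 / 2\<rbrakk>
     \<Longrightarrow> m1 (f z - f 0) \<le> K * cmod z * M"
    by (rule embedded_lipschitz_at_0[OF H]) blast
  have M: "M \<ge> 0" using bd[OF x] embedded_norm_nonneg[OF H, of "\<Phi> x"] by simp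
  \<comment> \<open>Half the distance to the sphere: the parameter disc of radius 2 then stays in
    the ball of radius \<open>R\<close>.\<close>
  define \<rho> where "\<rho> = (R - n1 x) / 2"
  have \<rho>: "\<rho> > 0" using x by (simp add: \<rho>_def)
  \<comment> \<open>The first entry makes \<open>cmod z\<close> at most 1/2, the second makes
    \<open>K * cmod z * M\<close> less than \<open>e\<close>; adding 1 keeps the denominator
    positive when \<open>M\<close> is 0.\<close>
  define d where "d = min (\<rho> / 2) (e * \<rho> / (K * M + 1))"
  have KM: "K * M + 1 > 0" using K(1) M by (simp add: add_nonneg_pos)
  have d: "d > 0" using \<rho> e KM by (simp add: d_def)
  have "m1 (\<Phi> y - \<Phi> x) < e" if y: "y \<in> E1" "n1 (y - x) < d" for y
  proof (cases "y = x")
    case True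
    then show ?thesis using e embedded_norm_eq_0[OF H embedded_zero[OF H]] by simp
  next
    case False
    define D where "D = n1 (y - x)"
    have yx: "y - x \<in> E1" by (rule embedded_diff[OF E y(1) x(1)])
    have D: "D > 0"
      using False embedded_norm_nonneg[OF E yx] embedded_norm_eq_0[OF E yx] by (simp add: D_def less_le)
    have Dd: "D < \<rho> / 2" "D < e * \<rho> / (K * M + 1)" using y(2) by (auto simp: D_def d_def)
    define h where "h = of_real (\<rho> / D) *\<^sub>C (y - x)"
    have h: "h \<in> E1" unfolding h_def by (rule embedded_scaleC[OF E yx])
    have nh: "n1 h = \<rho>"
      using D \<rho> by (simp add: h_def embedded_norm_scaleC[OF E yx] norm_divide flip: D_def)
    define f where "f w = \<Phi> (x + w *\<^sub>C h)" for w
    have inE: "x + w *\<^sub>C h \<in> E1 \<and> n1 (x + w *\<^sub>C h) < R" if "cmod w < 2" for w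
    proof -
      have wh: "w *\<^sub>C h \<in> E1" by (rule embedded_scaleC[OF E h])
      have "n1 (x + w *\<^sub>C h) \<le> n1 x + cmod w * \<rho>"
        using embedded_norm_add[OF E x(1) wh] by (simp add: embedded_norm_scaleC[OF E h] nh)
      also have "\<dots> < n1 x + 2 * \<rho>" using that \<rho> by simp
      also have "\<dots> = R" unfolding \<rho>_def by simp argo
      finally show ?thesis using embedded_add[OF E x(1) wh] by simp
    qed
    define z where "z = complex_of_real (D / \<rho>)"
    have nz: "cmod z = D / \<rho>" using D \<rho> by (simp add: z_def norm_divide)
    have zh: "z *\<^sub>C h = y - x"
    proof -
      have "z * of_real (\<rho> / D) = 1" using D \<rho> by (simp add: z_def flip: of_real_mult)
      then show ?thesis by (simp add: h_def scaleC_scaleC scaleC_one)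
    qed
    have "m1 (f z - f 0) \<le> K * cmod z * M"
    proof (rule K(2))
      fix \<psi> :: "'h \<Rightarrow> complex" assume \<psi>: "complex_functional \<psi>"
      have "(\<lambda>w. \<psi> (f w)) field_differentiable at w" if w: "w \<in> ball 0 2" for w
      proof -
        have "((\<lambda>w. w *\<^sub>C h) has_derivative (\<lambda>k. k *\<^sub>C h)) (at w)"
          by (rule bounded_linear_imp_has_derivative
              [OF bounded_bilinear.bounded_linear_left[OF bounded_bilinear_scaleC]])
        then have der: "((\<lambda>w. x + w *\<^sub>C h) has_derivative (\<lambda>k. k *\<^sub>C h)) (at w)"
          using has_derivative_add[OF has_derivative_const[of x]] by fastforce
        have "x + w *\<^sub>C h \<in> ball 0 R" using inE[of w] w E_le by force
        then have "complex_frechet_differentiable \<Phi> (x + w *\<^sub>C h)" using anal by blast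
        from complex_frechet_differentiable_compose[OF this der] complex_functional_differentiable[OF \<psi>]
        show ?thesis unfolding f_def by blast
      qed
      then show "(\<lambda>w. \<psi> (f w)) holomorphic_on ball 0 2"
        by (simp add: holomorphic_on_open field_differentiable_def)
    next
      fix w :: complex assume "cmod w < 1"
      then show "f w \<in> H1 \<and> m1 (f w) \<le> M" using inE[of w] bd[of "x + w *\<^sub>C h"] by (simp add: f_def)
    next
      show "cmod z \<le> 1 / 2" using Dd(1) \<rho> by (simp add: nz field_simps)
    qed
    also have "K * cmod z * M < e"
    proof -
      have "D * (K * M + 1) < e * \<rho>" using Dd(2) KM by (simp add: field_simps)
      then have "D * (K * M) < e * \<rho>" using D by (simp add: algebra_simps)
      then show ?thesis using \<rho> by (simp add: nz field_simps)
    qed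
    finally show ?thesis 
      using zh by (simp add: f_def bounded_bilinear.zero_left[OF bounded_bilinear_scaleC])
  qed
  with d show ?thesis by (rule that)
qed

section \<open>Interpolation\<close>

lemma bounded_range_tendsto_0_at_infinity:
  fixes u :: "real \<Rightarrow> real"
  assumes cont: "continuous_on UNIV u" and lim: "(u \<longlongrightarrow> 0) at_infinity"
  shows "bounded (range u)"
proof -
  have "\<forall>\<^sub>F t in at_infinity. \<bar>u t\<bar> < 1"
    using tendstoD[OF lim, of 1] by (simp add: dist_real_def)
  then obtain b where b: "\<And>t. b \<le> \<bar>t\<bar> \<Longrightarrow> \<bar>u t\<bar> < 1"
    by (auto simp: eventually_at_infinity)
  have "bounded (u ` {- b..b})"
    by (intro compact_imp_bounded compact_continuous_image continuous_on_subset[OF cont]) auto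
  moreover have "u t \<in> u ` {- b..b} \<or> u t \<in> ball 0 1" for t
    using b[of t] by (cases "b \<le> \<bar>t\<bar>") (auto simp: dist_real_def intro!: imageI)
  then have "range u \<subseteq> u ` {- b..b} \<union> ball 0 1" by blast
  ultimately show ?thesis using bounded_subset bounded_Un bounded_ball by metis
qed

text \<open>A supremum over the reals is informative only for sets bounded above. On the left line
  the bound on the strip suffices; on the right line that bound concerns the ambient norm only, and
  continuity with decay in \<open>n\<close> takes its place.\<close>

lemma interp_F_norm_bounds:
  assumes X: "banach_embedded X n" and f: "interp_F X n f"
  shows "norm (f (\<i> * of_real t)) \<le> interp_F_norm n f"
    and "n (f (1 + \<i> * of_real t)) \<le> interp_F_norm n f"
    and "0 \<le> interp_F_norm n f"
proof -
  define u where "u t = n (f (1 + \<i> * complex_of_real t))" for t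
  have fX: "f (1 + \<i> * complex_of_real t) \<in> X" for t using f by (simp add: interp_F_def)
  have "continuous_on UNIV u"
    unfolding continuous_on_iff
  proof (intro ballI allI impI)
    fix t e :: real assume "e > 0"
    then obtain d where d: "d > 0" "\<And>s. \<bar>s - t\<bar> < d \<Longrightarrow>
        n (f (1 + \<i> * complex_of_real s) - f (1 + \<i> * complex_of_real t)) < e"
      using f unfolding interp_F_def by blast
    have "\<bar>u s - u t\<bar> < e" if "\<bar>s - t\<bar> < d" for s
      using d(2)[OF that] embedded_norm_triangle[OF X fX[of s] fX[of t]]
        embedded_norm_triangle[OF X fX[of t] fX[of s]] embedded_norm_diff_commute[OF X fX[of t] fX[of s]]
      by (simp add: u_def abs_less_iff)
    then show "\<exists>d>0. \<forall>x'\<in>UNIV. dist x' t < d \<longrightarrow> dist (u x') (u t) < e"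
      using d(1) by (auto simp: dist_real_def)
  qed
  moreover have "(u \<longlongrightarrow> 0) at_infinity" using f by (simp add: interp_F_def u_def[abs_def])
  ultimately have bdd1: "bdd_above (range u)"
    by (intro bounded_imp_bdd_above bounded_range_tendsto_0_at_infinity)
  obtain B where "\<And>w. w \<in> strip \<Longrightarrow> norm (f w) \<le> B"
    using f by (auto simp: interp_F_def bounded_iff)
  then have bdd0: "bdd_above (range (\<lambda>t. norm (f (\<i> * complex_of_real t))))"
    by (intro bdd_aboveI2[of _ _ B]) (simp add: strip_def)
  show 0: "norm (f (\<i> * of_real t)) \<le> interp_F_norm n f" for t
    unfolding interp_F_norm_def by (intro max.coboundedI1 cSUP_upper[OF _ bdd0]) simp
  show "n (f (1 + \<i> * of_real t)) \<le> interp_F_norm n f"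
    using cSUP_upper[OF _ bdd1, of t] unfolding interp_F_norm_def u_def
    by (intro max.coboundedI2) simp
  show "0 \<le> interp_F_norm n f" using 0[of 0] norm_ge_zero order_trans by blast
qed

lemma interp_F_norm_leI:
  assumes "\<And>t. norm (f (\<i> * of_real t)) \<le> B" "\<And>t. n (f (1 + \<i> * of_real t)) \<le> B"
  shows "interp_F_norm n f \<le> B"
  unfolding interp_F_norm_def by (intro max.boundedI cSUP_least) (use assms in auto)

text \<open>Domination of the ambient norm by \<open>n\<close>, with constant 1, transfers the bound
  on the right line. The strict inequality keeps \<open>M\<close> positive even when
  \<open>f\<close> has norm 0.\<close>

lemma interp_F_norm_strip:
  assumes X: "banach_embedded X n" and le: "\<forall>x\<in>X. norm x \<le> n x" and f: "interp_F X n f"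
    and z: "z \<in> strip" and M: "interp_F_norm n f < M"
  shows "norm (f z) \<le> M"
proof (rule three_lines_vector[of f])
  note bounds = interp_F_norm_bounds[OF X f]
  show "M > 0" using bounds(3) M by linarith
  fix w :: complex assume "Re w = 0 \<or> Re w = 1"
  then show "norm (f w) \<le> M"
  proof
    assume "Re w = 0"
    then have "w = \<i> * of_real (Im w)" by (simp add: complex_eq_iff)
    then show ?thesis using bounds(1)[of "Im w"] M by simp
  next
    assume "Re w = 1"
    then have "w = 1 + \<i> * of_real (Im w)" by (simp add: complex_eq_iff)
    moreover have "norm (f (1 + \<i> * of_real (Im w))) \<le> n (f (1 + \<i> * of_real (Im w)))"
      using le f by (simp add: interp_F_def)
    ultimately show ?thesis using bounds(2)[of "Im w"] M by simp
  qed
qed (use f z in \<open>auto simp: interp_F_def\<close>)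

lemma interp_F_compose:
  fixes \<Phi> :: "'e::complex_normed_vector \<Rightarrow> 'h::complex_normed_vector"
  assumes E: "banach_embedded E1 n1" and E_le: "\<forall>x\<in>E1. norm x \<le> n1 x"
    and H: "banach_embedded H1 m1"
    and anal: "\<forall>x\<in>ball 0 R. complex_frechet_differentiable \<Phi> x"
    and C0: "C0 > 0" and C1: "C1 > 0"
    and bd0: "\<forall>x\<in>ball 0 R. norm (\<Phi> x) \<le> C0 * norm x"
    and bd1: "\<forall>x\<in>E1. n1 x < R \<longrightarrow> \<Phi> x \<in> H1 \<and> m1 (\<Phi> x) \<le> C1 * n1 x"
    and f: "interp_F E1 n1 f" "interp_F_norm n1 f < R"
  obtains h where "interp_F H1 m1 h" "h (of_real \<theta>) = \<Phi> (f (of_real \<theta>))"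
    "interp_F_norm m1 h \<le> C0 powr (1 - \<theta>) * C1 powr \<theta> * interp_F_norm n1 f"
proof -
  define N where "N = interp_F_norm n1 f"
  note bounds = interp_F_norm_bounds[OF E f(1), folded N_def]
  \<comment> \<open>A bound strictly below \<open>R\<close>, so that the values on the closed strip
    lie in the open ball.\<close>
  define M where "M = (N + R) / 2"
  have M: "N < M" "M < R" using f(2) by (auto simp: M_def N_def)
  have fM: "norm (f z) \<le> M" if "z \<in> strip" for z
    by (rule interp_F_norm_strip[OF E E_le f(1) that]) (use M N_def in auto)
  then have fR: "f z \<in> ball 0 R" if "z \<in> strip" for z using that M by fastforce
  have f1: "f (1 + \<i> * of_real t) \<in> E1" "n1 (f (1 + \<i> * of_real t)) < R" for t
    using f bounds(2)[of t] M by (auto simp: interp_F_def)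
  define k where "k = ln C0 - ln C1"
  \<comment> \<open>It equals 1 at \<open>\<theta>\<close>, and its modulus depends on the real part
    alone; the two boundary moduli turn \<open>C0\<close> and \<open>C1\<close> into the same
    constant \<open>P\<close>.\<close>
  define c where "c z = exp ((z - of_real \<theta>) * of_real k)" for z :: complex
  have nc: "cmod (c z) = exp ((Re z - \<theta>) * k)" for z by (simp add: c_def norm_exp_eq_Re)
  define P where "P = C0 powr (1 - \<theta>) * C1 powr \<theta>"
  have P0: "exp (- \<theta> * k) * C0 = P"
  proof -
    have "exp (- \<theta> * k) * C0 = exp (- \<theta> * k + ln C0)" using C0 unfolding exp_add by simp
    also have "\<dots> = exp ((1 - \<theta>) * ln C0 + \<theta> * ln C1)" by (simp add: k_def algebra_simps)
    finally show ?thesis using C0 C1 by (simp add: P_def powr_def exp_add)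
  qed
  have P1: "exp ((1 - \<theta>) * k) * C1 = P"
  proof -
    have "exp ((1 - \<theta>) * k) * C1 = exp ((1 - \<theta>) * k + ln C1)" using C1 unfolding exp_add by simp
    also have "\<dots> = exp ((1 - \<theta>) * ln C0 + \<theta> * ln C1)" by (simp add: k_def algebra_simps)
    finally show ?thesis using C0 C1 by (simp add: P_def powr_def exp_add)
  qed
  have P: "P \<ge> 0" by (simp add: P_def)
  define h where "h z = c z *\<^sub>C \<Phi> (f z)" for z
  have h0: "norm (h (\<i> * of_real t)) \<le> P * norm (f (\<i> * of_real t))" for t
  proof -
    have "norm (\<Phi> (f (\<i> * of_real t))) \<le> C0 * norm (f (\<i> * of_real t))"
      using bd0 fR[of "\<i> * of_real t"] by (simp add: strip_def)
    then have "norm (h (\<i> * of_real t)) \<le> exp (- \<theta> * k) * (C0 * norm (f (\<i> * of_real t)))"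
      by (simp add: h_def norm_scaleC nc)
    then show ?thesis by (simp only: P0 mult.assoc[symmetric])
  qed
  have \<Phi>1: "\<Phi> (f (1 + \<i> * of_real t)) \<in> H1" "m1 (\<Phi> (f (1 + \<i> * of_real t))) \<le> C1 * n1 (f (1 + \<i> * of_real t))" for t
    using bd1 f1[of t] by auto
  have h1: "h (1 + \<i> * of_real t) \<in> H1" "m1 (h (1 + \<i> * of_real t)) \<le> P * n1 (f (1 + \<i> * of_real t))" for t
  proof -
    show "h (1 + \<i> * of_real t) \<in> H1" unfolding h_def by (rule embedded_scaleC[OF H \<Phi>1(1)])
    have "m1 (h (1 + \<i> * of_real t)) \<le> exp ((1 - \<theta>) * k) * (C1 * n1 (f (1 + \<i> * of_real t)))"
      using \<Phi>1(2)[of t] by (simp add: h_def embedded_norm_scaleC[OF H \<Phi>1(1)] nc)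
    then show "m1 (h (1 + \<i> * of_real t)) \<le> P * n1 (f (1 + \<i> * of_real t))"
      by (simp only: P1 mult.assoc[symmetric])
  qed
  have cont\<Phi>: "continuous_on (ball 0 R) \<Phi>"
    using anal has_derivative_continuous unfolding complex_frechet_differentiable_def
    by (intro continuous_at_imp_continuous_on) blast
  have conth: "continuous_on strip h"
  proof -
    have "continuous_on strip (\<lambda>z. \<Phi> (f z))"
      using f(1) fR by (intro continuous_on_compose2[OF cont\<Phi>]) (auto simp: interp_F_def)
    moreover have "continuous_on strip c" unfolding c_def by (intro continuous_intros)
    ultimately show ?thesis
      unfolding h_def by (intro bounded_bilinear.continuous_on[OF bounded_bilinear_scaleC])
  qed
  have bddh: "bounded (h ` strip)"
  proof -
    have "norm (h z) \<le> exp ((1 + \<bar>\<theta>\<bar>) * \<bar>k\<bar>) * (C0 * M)" if z: "z \<in> strip" for z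
    proof -
      have "(Re z - \<theta>) * k \<le> \<bar>Re z - \<theta>\<bar> * \<bar>k\<bar>" by (metis abs_ge_self abs_mult)
      also have "\<dots> \<le> (1 + \<bar>\<theta>\<bar>) * \<bar>k\<bar>" using z by (intro mult_right_mono) (auto simp: strip_def)
      finally have "cmod (c z) \<le> exp ((1 + \<bar>\<theta>\<bar>) * \<bar>k\<bar>)" by (simp add: nc)
      moreover have "norm (\<Phi> (f z)) \<le> C0 * norm (f z)" using bd0 fR[OF z] by blast
      then have "norm (\<Phi> (f z)) \<le> C0 * M"
        using fM[OF z] C0 by (meson less_imp_le mult_left_mono order_trans)
      ultimately show ?thesis by (simp add: h_def norm_scaleC mult_mono)
    qed
    then show ?thesis by (auto simp: bounded_iff)
  qed
  have derh: "\<exists>v. (h has_derivative (\<lambda>w. w *\<^sub>C v)) (at z)" if z: "z \<in> open_strip" for z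
  proof -
    have zs: "z \<in> strip" using z by (simp add: open_strip_def strip_def)
    obtain v where "(f has_derivative (\<lambda>w. w *\<^sub>C v)) (at z)" using f(1) z by (auto simp: interp_F_def)
    moreover have "complex_frechet_differentiable \<Phi> (f z)" using anal fR[OF zs] by blast
    ultimately obtain v where v: "((\<lambda>z. \<Phi> (f z)) has_derivative (\<lambda>w. w *\<^sub>C v)) (at z)"
      using complex_frechet_differentiable_compose by blast
    have "(c has_field_derivative (c z * of_real k)) (at z)"
      unfolding c_def by (auto intro!: derivative_eq_intros)
    then have "(c has_derivative (\<lambda>w. (c z * of_real k) * w)) (at z)"
      by (simp add: has_field_derivative_def)
    from bounded_bilinear.FDERIV[OF bounded_bilinear_scaleC this v]
    have "(h has_derivative (\<lambda>w. c z *\<^sub>C w *\<^sub>C v + ((c z * of_real k) * w) *\<^sub>C \<Phi> (f z))) (at z)"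
      unfolding h_def[abs_def] .
    moreover have "c z *\<^sub>C w *\<^sub>C v + ((c z * of_real k) * w) *\<^sub>C \<Phi> (f z)
        = w *\<^sub>C (c z *\<^sub>C v + (c z * of_real k) *\<^sub>C \<Phi> (f z))" for w
      by (simp add: scaleC_add_right scaleC_scaleC mult_ac)
    ultimately show ?thesis by auto
  qed
  have cont1: "\<exists>d>0. \<forall>s. \<bar>s - t\<bar> < d \<longrightarrow>
      m1 (h (1 + \<i> * of_real s) - h (1 + \<i> * of_real t)) < e" if e: "e > 0" for t e :: real
  proof -
    define g where "g s = \<Phi> (f (1 + \<i> * complex_of_real s))" for s
    define b where "b s = c (1 + \<i> * complex_of_real s)" for s
    have g: "g s \<in> H1" for s by (simp add: g_def \<Phi>1)
    define q where "q = exp ((1 - \<theta>) * k)"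
    have q: "q > 0" "cmod (b s) = q" for s by (auto simp: q_def b_def nc)
    \<comment> \<open>Adding 1 permits division by \<open>G\<close> when \<open>g t\<close> is
      0.\<close>
    define G where "G = m1 (g t) + 1"
    have G: "G > 0" using embedded_norm_nonneg[OF H g[of t]] by (simp add: G_def)
    have bdd: "\<Phi> x \<in> H1 \<and> m1 (\<Phi> x) \<le> C1 * R" if "x \<in> E1" "n1 x < R" for x
    proof -
      have "C1 * n1 x \<le> C1 * R" using that C1 by simp
      then show ?thesis using bd1 that by fastforce
    qed
    obtain d0 where d0: "d0 > 0" "\<And>y. y \<in> E1 \<Longrightarrow> n1 (y - f (1 + \<i> * of_real t)) < d0 \<Longrightarrow>
        m1 (\<Phi> y - \<Phi> (f (1 + \<i> * of_real t))) < e / 2 / q"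
      by (rule embedded_restriction_continuous[OF E E_le H anal bdd f1[of t], of "e / 2 / q"])
        (use e q(1) in auto)
    obtain d1 where d1: "d1 > 0" "\<And>s. \<bar>s - t\<bar> < d1 \<Longrightarrow>
        n1 (f (1 + \<i> * of_real s) - f (1 + \<i> * of_real t)) < d0"
      using f(1) d0(1) unfolding interp_F_def by blast
    have "continuous_on UNIV b" unfolding b_def c_def by (intro continuous_intros)
    moreover have "e / 2 / G > 0" using e G by simp
    ultimately obtain d2 where d2: "d2 > 0" "\<And>s. \<bar>s - t\<bar> < d2 \<Longrightarrow> cmod (b s - b t) < e / 2 / G"
      unfolding continuous_on_iff dist_norm real_norm_def by blast
    have "m1 (h (1 + \<i> * of_real s) - h (1 + \<i> * of_real t)) < e" if s: "\<bar>s - t\<bar> < min d1 d2" for s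
    proof -
      have gs: "g s - g t \<in> H1" by (rule embedded_diff[OF H g g])
      \<comment> \<open>The increment of \<open>g\<close> is paired with the multiplier at
        \<open>s\<close>, whose modulus \<open>q\<close> is constant on the line; hence
        \<open>d0\<close> can be chosen independently of \<open>s\<close>.\<close>
      have "h (1 + \<i> * of_real s) - h (1 + \<i> * of_real t) = b s *\<^sub>C (g s - g t) + (b s - b t) *\<^sub>C g t"
        by (simp add: h_def g_def b_def scaleC_diff_right scaleC_diff_left)
      then have "m1 (h (1 + \<i> * of_real s) - h (1 + \<i> * of_real t))
          \<le> m1 (b s *\<^sub>C (g s - g t)) + m1 ((b s - b t) *\<^sub>C g t)"
        using embedded_norm_add[OF H embedded_scaleC[OF H gs] embedded_scaleC[OF H g]] by simp
      also have "\<dots> = q * m1 (g s - g t) + cmod (b s - b t) * m1 (g t)"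
        by (simp add: embedded_norm_scaleC[OF H gs] embedded_norm_scaleC[OF H g] q)
      also have "q * m1 (g s - g t) < e / 2"
        using d0(2)[OF f1(1) d1(2)] s q(1) by (simp add: g_def field_simps)
      also have "cmod (b s - b t) * m1 (g t) \<le> cmod (b s - b t) * G"
        by (intro mult_left_mono) (auto simp: G_def)
      also have "\<dots> \<le> e / 2"
        using d2(2)[of s] s G by (simp add: field_simps)
      finally show ?thesis by simp
    qed
    then show ?thesis using d1(1) d2(1) by (intro exI[of _ "min d1 d2"]) auto
  qed
  have lim0: "((\<lambda>t. norm (h (\<i> * of_real t))) \<longlongrightarrow> 0) at_infinity"
  proof (rule Lim_null_comparison)
    show "\<forall>\<^sub>F t in at_infinity. norm (norm (h (\<i> * of_real t))) \<le> P * norm (f (\<i> * of_real t))"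
      using h0 by simp
    show "((\<lambda>t. P * norm (f (\<i> * of_real t))) \<longlongrightarrow> 0) at_infinity"
      using f(1) by (intro tendsto_mult_right_zero) (simp add: interp_F_def)
  qed
  have lim1: "((\<lambda>t. m1 (h (1 + \<i> * of_real t))) \<longlongrightarrow> 0) at_infinity"
  proof (rule Lim_null_comparison)
    show "\<forall>\<^sub>F t in at_infinity. norm (m1 (h (1 + \<i> * of_real t))) \<le> P * n1 (f (1 + \<i> * of_real t))"
      using h1 embedded_norm_nonneg[OF H h1(1)] by simp
    show "((\<lambda>t. P * n1 (f (1 + \<i> * of_real t))) \<longlongrightarrow> 0) at_infinity"
      using f(1) by (intro tendsto_mult_right_zero) (simp add: interp_F_def)
  qed
  have "continuous_on UNIV (\<lambda>t::real. h (\<i> * of_real t))"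
    by (rule continuous_on_compose2[OF conth]) (auto intro!: continuous_intros simp: strip_def)
  then have "interp_F H1 m1 h"
    unfolding interp_F_def using bddh conth derh h1(1) cont1 lim0 lim1 by blast
  moreover have "h (of_real \<theta>) = \<Phi> (f (of_real \<theta>))"
    by (simp add: h_def c_def scaleC_one)
  moreover have "interp_F_norm m1 h \<le> P * N"
  proof (rule interp_F_norm_leI)
    show "norm (h (\<i> * of_real t)) \<le> P * N" for t
      using h0[of t] mult_left_mono[OF bounds(1) P, of t] by linarith
    show "m1 (h (1 + \<i> * of_real t)) \<le> P * N" for t
      using h1(2)[of t] mult_left_mono[OF bounds(2) P, of t] by linarith
  qed
  ultimately show ?thesis unfolding P_def N_def by (rule that)
qed

section \<open>Passage to the infimum\<close>

lemma interp_norm_le: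
  assumes X: "banach_embedded X n" and f: "interp_F X n f" "f (of_real \<theta>) = x"
  shows "interp_norm X n \<theta> x \<le> interp_F_norm n f"
  unfolding interp_norm_def
proof (rule cInf_lower)
  show "bdd_below {interp_F_norm n f |f. interp_F X n f \<and> f (of_real \<theta>) = x}"
    by (rule bdd_belowI[of _ 0]) (use interp_F_norm_bounds(3)[OF X] in blast)
qed (use f in blast)

lemma interp_norm_approx:
  assumes "x \<in> interp_space X n \<theta>" "interp_norm X n \<theta> x < b"
  obtains f where "interp_F X n f" "f (of_real \<theta>) = x" "interp_F_norm n f < b"
proof -
  have "{interp_F_norm n f |f. interp_F X n f \<and> f (of_real \<theta>) = x} \<noteq> {}"
    using assms(1) by (auto simp: interp_space_def)
  from cInf_lessD[OF this] assms(2) that show ?thesis unfolding interp_norm_def by blast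
qed

lemma interp_norm_nonneg:
  assumes "banach_embedded X n" "x \<in> interp_space X n \<theta>"
  shows "0 \<le> interp_norm X n \<theta> x"
  unfolding interp_norm_def
  by (rule cInf_greatest) (use assms interp_F_norm_bounds(3) in \<open>auto simp: interp_space_def\<close>)

text \<open>This limit removes the perturbation of the constants. For \<open>b = 0\<close> the base
  is positive as soon as \<open>\<epsilon>\<close> is, so the power is constantly 1, in agreement
  with the convention of \<open>rpow\<close>.\<close>

lemma tendsto_rpow_at_right:
  assumes "a \<ge> 0" "b \<ge> 0"
  shows "((\<lambda>\<epsilon>. (a + \<epsilon>) powr b) \<longlongrightarrow> rpow a b) (at_right 0)"
proof (cases "b = 0")
  case True
  have "\<forall>\<^sub>F \<epsilon> in at_right 0. (a + \<epsilon>) powr b = rpow a b"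
    using assms True by (auto simp: rpow_def eventually_at_filter intro!: always_eventually)
  then show ?thesis by (rule tendsto_eventually)
next
  case False
  have lim: "((\<lambda>\<epsilon>. a + \<epsilon>) \<longlongrightarrow> a + 0) (at_right 0)" by (intro tendsto_intros)
  have "\<forall>\<^sub>F \<epsilon> in at_right 0. a + \<epsilon> \<ge> 0"
    using assms by (auto simp: eventually_at_filter intro!: always_eventually)
  with lim have "((\<lambda>\<epsilon>. (a + \<epsilon>) powr b) \<longlongrightarrow> a powr b) (at_right 0)"
    using False assms by (intro tendsto_powr') auto
  with False show ?thesis by (simp add: rpow_def)
qed

text \<open>Two limits are taken in turn: the perturbation of the constants tends to 0 for a fixed
  admissible function, then the norm of that function descends to the interpolation norm of
  \<open>x\<close>. Both are one-sided.\<close>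

theorem theorem1:
  fixes E1 :: "'e::{complex_normed_vector,banach} set" and n1 :: "'e \<Rightarrow> real"
    and H1 :: "'h::{complex_normed_vector,banach} set" and m1 :: "'h \<Rightarrow> real"
    and \<Phi> :: "'e \<Rightarrow> 'h" and R C0 C1 :: real
  assumes E: "banach_embedded E1 n1"
    and E_le: "\<forall>x\<in>E1. norm x \<le> n1 x"
    and H: "banach_embedded H1 m1"
    and R: "R > 0"
    and C0: "C0 \<ge> 0" and C1: "C1 \<ge> 0"
    and anal: "\<forall>x\<in>ball 0 R. complex_frechet_differentiable \<Phi> x"
    and bd0: "\<forall>x\<in>ball 0 R. norm (\<Phi> x) \<le> C0 * norm x"
    and bd1: "\<forall>x\<in>E1. n1 x < R \<longrightarrow> \<Phi> x \<in> H1 \<and> m1 (\<Phi> x) \<le> C1 * n1 x"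
  shows "\<forall>\<theta>\<in>{0..1}. \<forall>r\<in>{0<..<R}. \<forall>x\<in>interp_space E1 n1 \<theta>.
           interp_norm E1 n1 \<theta> x < r \<longrightarrow>
             \<Phi> x \<in> interp_space H1 m1 \<theta>
           \<and> interp_norm H1 m1 \<theta> (\<Phi> x)
               \<le> rpow C0 (1 - \<theta>) * rpow C1 \<theta> * (R / (R - r)) * interp_norm E1 n1 \<theta> x"
proof (intro ballI impI)
  fix \<theta> r x
  assume \<theta>: "\<theta> \<in> {0..1::real}" and r: "r \<in> {0<..<R}"
    and x: "x \<in> interp_space E1 n1 \<theta>" "interp_norm E1 n1 \<theta> x < r"
  define I where "I = interp_norm E1 n1 \<theta> x"
  have I: "0 \<le> I" "I < R" using interp_norm_nonneg[OF E x(1)] x(2) r by (auto simp: I_def)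
  \<comment> \<open>Both constants are raised by \<open>\<epsilon>\<close> so that their logarithms
    make sense; the bounds on \<open>\<Phi>\<close> only become weaker.\<close>
  have compose: "\<exists>h. interp_F H1 m1 h \<and> h (of_real \<theta>) = \<Phi> x \<and>
      interp_F_norm m1 h \<le> (C0 + \<epsilon>) powr (1 - \<theta>) * (C1 + \<epsilon>) powr \<theta> * interp_F_norm n1 f"
    if \<epsilon>: "\<epsilon> > 0" and f: "interp_F E1 n1 f" "f (of_real \<theta>) = x" "interp_F_norm n1 f < R" for \<epsilon> f
  proof -
    have "\<forall>x\<in>ball 0 R. norm (\<Phi> x) \<le> (C0 + \<epsilon>) * norm x"
      using bd0 \<epsilon> by (force simp: distrib_right intro: add_increasing2)
    moreover have "\<forall>x\<in>E1. n1 x < R \<longrightarrow> \<Phi> x \<in> H1 \<and> m1 (\<Phi> x) \<le> (C1 + \<epsilon>) * n1 x"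
      using bd1 \<epsilon> embedded_norm_nonneg[OF E] by (force simp: distrib_right intro: add_increasing2)
    ultimately show ?thesis
      using interp_F_compose[OF E E_le H anal _ _ _ _ f(1,3), of "C0 + \<epsilon>" "C1 + \<epsilon>" \<theta>] C0 C1 \<epsilon> f(2)
      by (metis add_nonneg_pos)
  qed
  define P where "P = rpow C0 (1 - \<theta>) * rpow C1 \<theta>"
  have P: "P \<ge> 0" by (simp add: P_def rpow_def)
  have le: "interp_norm H1 m1 \<theta> (\<Phi> x) \<le> P * interp_F_norm n1 f"
    if f: "interp_F E1 n1 f" "f (of_real \<theta>) = x" "interp_F_norm n1 f < R" for f
  proof (rule tendsto_lowerbound)
    show "((\<lambda>\<epsilon>. (C0 + \<epsilon>) powr (1 - \<theta>) * (C1 + \<epsilon>) powr \<theta> * interp_F_norm n1 f)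
        \<longlongrightarrow> P * interp_F_norm n1 f) (at_right 0)"
      unfolding P_def using C0 C1 \<theta> by (intro tendsto_intros tendsto_rpow_at_right) auto
    have "interp_norm H1 m1 \<theta> (\<Phi> x) \<le> (C0 + \<epsilon>) powr (1 - \<theta>) * (C1 + \<epsilon>) powr \<theta> * interp_F_norm n1 f"
      if \<epsilon>: "\<epsilon> > 0" for \<epsilon>
    proof -
      obtain h where h: "interp_F H1 m1 h" "h (of_real \<theta>) = \<Phi> x" "interp_F_norm m1 h
          \<le> (C0 + \<epsilon>) powr (1 - \<theta>) * (C1 + \<epsilon>) powr \<theta> * interp_F_norm n1 f"
        using compose[OF \<epsilon> f] by blast
      from interp_norm_le[OF H h(1,2)] h(3) show ?thesis by simp
    qed
    then show "\<forall>\<^sub>F \<epsilon> in at_right 0. interp_norm H1 m1 \<theta> (\<Phi> x)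
        \<le> (C0 + \<epsilon>) powr (1 - \<theta>) * (C1 + \<epsilon>) powr \<theta> * interp_F_norm n1 f"
      by (auto simp: eventually_at_filter intro!: always_eventually)
  qed simp
  have "interp_norm H1 m1 \<theta> (\<Phi> x) \<le> P * I"
  proof (rule tendsto_lowerbound)
    show "((\<lambda>b. P * b) \<longlongrightarrow> P * I) (at_right I)" by (intro tendsto_intros)
    have "interp_norm H1 m1 \<theta> (\<Phi> x) \<le> P * b" if b: "I < b" "b < R" for b
    proof -
      obtain f where f: "interp_F E1 n1 f" "f (of_real \<theta>) = x" "interp_F_norm n1 f < b"
        by (rule interp_norm_approx[OF x(1) b(1)[unfolded I_def]])
      have "interp_norm H1 m1 \<theta> (\<Phi> x) \<le> P * interp_F_norm n1 f"
        using f b by (intro le) auto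
      also have "\<dots> \<le> P * b" using f P by (intro mult_left_mono) auto
      finally show ?thesis .
    qed
    then show "\<forall>\<^sub>F b in at_right I. interp_norm H1 m1 \<theta> (\<Phi> x) \<le> P * b"
      using eventually_at_right_less[of I] eventually_at_right_real[OF I(2)]
      by (auto elim: eventually_mono)
  qed simp
  \<comment> \<open>The estimate is relaxed to the stated form: the new factor is at least 1 and
    \<open>P\<close>, \<open>I\<close> are nonnegative.\<close>
  also have "P * I \<le> P * (R / (R - r)) * I"
  proof -
    have "1 \<le> R / (R - r)" using r by simp
    then have "P * 1 * I \<le> P * (R / (R - r)) * I"
      using P I by (intro mult_right_mono mult_left_mono)
    then show ?thesis by simp
  qed
  finally have "interp_norm H1 m1 \<theta> (\<Phi> x) \<le> P * (R / (R - r)) * I" .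
  moreover have "\<Phi> x \<in> interp_space H1 m1 \<theta>"
  proof -
    obtain f where "interp_F E1 n1 f" "f (of_real \<theta>) = x" "interp_F_norm n1 f < R"
      by (rule interp_norm_approx[OF x(1) I(2)[unfolded I_def]])
    \<comment> \<open>Membership involves no constant, so the perturbation 1 will do.\<close>
    then obtain h where "interp_F H1 m1 h" "h (of_real \<theta>) = \<Phi> x"
      using compose[OF zero_less_one] by blast
    then show ?thesis unfolding interp_space_def mem_Collect_eq by metis
  qed
  ultimately show "\<Phi> x \<in> interp_space H1 m1 \<theta> \<and> interp_norm H1 m1 \<theta> (\<Phi> x)
               \<le> rpow C0 (1 - \<theta>) * rpow C1 \<theta> * (R / (R - r)) * interp_norm E1 n1 \<theta> x"
    by (simp add: P_def I_def)
qed

end
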